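(* Let $\mathcal{A} \subset B(H)$ be the C*-algebra generated by $\mathcal{U} \cup \mathcal{V}$, where $H$, $\mathcal{U}$ and $\mathcal{V}$ are obtained by the transfinite construction described in the context (for any choices made in that construction). Then $\mathcal{A}$ is prime but not primitive.
   Context: Conventions. A C*-algebra is prime if the intersection of any two nonzero closed two-sided ideals is nonzero. It is primitive if it has a faithful irreducible representation on a Hilbert space. $\mathbf{N} = \{1,2,3,\ldots\}$; $\mathbf{R}^n = \{a : \{1,\ldots,n\} \to \mathbf{R}\}$ for $n \in \mathbf{N}$, and $n$ is called the length of $a \in \mathbf{R}^n$. A tuple $a \in \mathbf{R}^m$ extends $b \in \mathbf{R}^n$ if $m \geq n$ and $a(i) = b(i)$ for $1 \leq i \leq n$; it properly extends $b$ if moreover $m > n$. $2^{\aleph_0}$ also denotes the smallest ordinal of cardinality $2^{\aleph_0}$. "Countable" includes finite. Construction. Let $X = \{x : \mathbf{N} \to \mathbf{R}\}$ be the set of all sequences of real numbers, with counting measure, and let $H = l^2(X)$. For $a \in \mathbf{R}^n$ let $X_a = \{x \in X : x(i) = a(i) \text{ for } 1 \leq i \leq n\}$ and let $P_a \in B(H)$ be the orthogonal projection onto $l^2(X_a) \subset l^2(X)$. Let $\mathcal{U}_n = \{P_a : a \in \mathbf{R}^n\}$ and $\mathcal{U} = \bigcup_{n \geq 1} \mathcal{U}_n$. (The tuple $a$ is determined by $P_a$.) For $n \in \mathbf{N}$ and $a, b \in \mathbf{R}^n$ let $f_{a,b} : X_b \to X_a$ be the bijection given by $f_{a,b}(x)(i)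 = a(i)$ if $i \leq n$ and $f_{a,b}(x)(i) = x(i)$ if $i > n$. Let $V_{a,b} \in B(H)$ be the partial isometry that sends $\xi \in l^2(X_a)$ to $\xi \circ f_{a,b} \in l^2(X_b)$ and is zero on the orthogonal complement of $l^2(X_a)$; it has domain projection $P_a$ and range projection $P_b$. Let $\mathcal{W}_1 = \mathcal{U} \times \mathcal{U}$ and $\mathcal{W}_2 = \{Z \subset \mathcal{U} : Z \text{ is countable}\}$. Both have cardinality $2^{\aleph_0}$; fix bijections $\phi_i : 2^{\aleph_0} \to \mathcal{W}_i$ for $i = 1, 2$. Define $n_\sigma \in \mathbf{N}$ and $a_\sigma, b_\sigma \in \mathbf{R}^{n_\sigma}$ for all $\sigma < 2^{\aleph_0}$ by transfinite recursion as follows. Suppose $n_\tau, a_\tau, b_\tau$ are defined for all $\tau < \sigma$. Write $\phi_1(\sigma) = (P_a, P_b)$ and let $n_\sigma = \max(\mathrm{length}(a), \mathrm{length}(b)) + 1$. Let $$S_\sigma = \{a_\tau(n_\sigma), b_\tau(n_\sigma) : \tau < \sigma \text{ and } n_\sigma \leq n_\tau\},$$ $$T_\sigma = \{c(n_\sigma) : P_c \in \phi_2(\tau) \text{ for some } \tau < \sigma \text{ and } n_\sigma \leq \mathrm{length}(c)\},$$ and $R_\sigma = S_\sigma \cup T_\sigma$. Since $R_\sigma$ has cardinality strictly less than $2^{\aleph_0}$, choose $r \in \mathbf{R} \setminus R_\sigma$, and choose $a_\sigma, b_\sigma \in \mathbf{R}^{n_\sigma}$ extending $a$ and $b$ respectively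 with $a_\sigma(n_\sigma) = b_\sigma(n_\sigma) = r$. Let $V_\sigma = V_{a_\sigma, b_\sigma}$ and $\mathcal{V} = \{V_\sigma : \sigma < 2^{\aleph_0}\}$. Let $\mathcal{A}$ be the C*-subalgebra of $B(H)$ generated by $\mathcal{U} \cup \mathcal{V}$ (it is not unital). *)

theory Defs
  imports "HOL-Analysis.Analysis"
begin

section \<open>Complex Hilbert spaces\<close>

text \<open>The inner product is linear in the first argument.\<close>

class chilbert_space = banach +
  fixes scaleC :: "complex \<Rightarrow> 'a \<Rightarrow> 'a" (infixr "*\<^sub>C" 75)
    and cinner :: "'a \<Rightarrow> 'a \<Rightarrow> complex"
  assumes scaleC_add_right: "c *\<^sub>C (x + y) = c *\<^sub>C x + c *\<^sub>C y"
    and scaleC_add_left: "(c + d) *\<^sub>C x = c *\<^sub>C x + d *\<^sub>C x"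
    and scaleC_scaleC: "c *\<^sub>C d *\<^sub>C x = (c * d) *\<^sub>C x"
    and scaleR_conv_scaleC: "t *\<^sub>R x = complex_of_real t *\<^sub>C x"
    and cinner_commute: "cinner x y = cnj (cinner y x)"
    and cinner_add_left: "cinner (x + y) z = cinner x z + cinner y z"
    and cinner_scaleC_left: "cinner (c *\<^sub>C x) y = c * cinner x y"
    and cinner_self: "cinner x x = complex_of_real ((norm x)\<^sup>2)"

lemma scaleC_one [simp]: "1 *\<^sub>C (x::'a::chilbert_space) = x"
  using scaleR_conv_scaleC[of 1 x] by simp

lemma scaleC_zero_left [simp]: "0 *\<^sub>C (x::'a::chilbert_space) = 0"
  using scaleR_conv_scaleC[of 0 x] by simp

lemma scaleC_zero_right [simp]: "c *\<^sub>C (0::'a::chilbert_space) = 0"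
  using scaleC_add_right[of c "0::'a" 0] by simp

lemma scaleC_minus1: "(-1) *\<^sub>C (x::'a::chilbert_space) = - x"
  using scaleR_conv_scaleC[of "-1" x] by simp

lemma cinner_zero_left [simp]: "cinner 0 (x::'a::chilbert_space) = 0"
  using cinner_add_left[of 0 0 x] by simp

lemma cinner_zero_right [simp]: "cinner (x::'a::chilbert_space) 0 = 0"
  by (subst cinner_commute) simp

lemma cinner_add_right:
  "cinner (x::'a::chilbert_space) (y + z) = cinner x y + cinner x z"
  by (metis cinner_add_left cinner_commute complex_cnj_add)

lemma cinner_scaleC_right: "cinner (x::'a::chilbert_space) (c *\<^sub>C y) = cnj c * cinner x y"
  by (metis cinner_scaleC_left cinner_commute complex_cnj_mult)

lemma cinner_minus_left: "cinner (- (x::'a::chilbert_space)) y = - cinner x y"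
  by (metis cinner_scaleC_left scaleC_minus1 mult_minus1)

lemma cinner_minus_right: "cinner (x::'a::chilbert_space) (- y) = - cinner x y"
  by (metis cinner_commute cinner_minus_left complex_cnj_minus)

lemma cinner_diff_left: "cinner ((x::'a::chilbert_space) - y) z = cinner x z - cinner y z"
  using cinner_add_left[of x "- y" z] by (simp add: cinner_minus_left)

lemma cinner_diff_right: "cinner (x::'a::chilbert_space) (y - z) = cinner x y - cinner x z"
  using cinner_add_right[of x y "- z"] by (simp add: cinner_minus_right)

lemma cinner_self_eq_0: "cinner x x = 0 \<longleftrightarrow> (x::'a::chilbert_space) = 0"
  by (simp add: cinner_self)

lemma cinner_left_ext:
  assumes "\<And>y. cinner x y = cinner x' y"
  shows "(x::'a::chilbert_space) = x'"
  using assms[of "x - x'"] cinner_self_eq_0[of "x - x'"] by (simp add: cinner_diff_left)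

lemma norm_scaleC: "norm (c *\<^sub>C (x::'a::chilbert_space)) = cmod c * norm x"
proof -
  have "complex_of_real ((norm (c *\<^sub>C x))\<^sup>2) = c * cnj c * complex_of_real ((norm x)\<^sup>2)"
    unfolding cinner_self[symmetric] by (simp add: cinner_scaleC_left cinner_scaleC_right)
  also have "\<dots> = complex_of_real ((cmod c * norm x)\<^sup>2)"
    by (simp only: complex_norm_square[symmetric] of_real_mult[symmetric] of_real_power[symmetric]
        power_mult_distrib)
  finally have "(norm (c *\<^sub>C x))\<^sup>2 = (cmod c * norm x)\<^sup>2"
    by (simp only: of_real_eq_iff)
  then show ?thesis
    by (rule power2_eq_imp_eq) auto
qed

lemma bounded_linear_scaleC: "bounded_linear (\<lambda>x::'a::chilbert_space. c *\<^sub>C x)"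
proof (rule bounded_linear_intro[where K = "cmod c"])
  show "c *\<^sub>C (t *\<^sub>R x) = t *\<^sub>R c *\<^sub>C x" for t and x :: 'a
    by (simp add: scaleR_conv_scaleC scaleC_scaleC mult.commute)
qed (simp_all add: scaleC_add_right norm_scaleC)


section \<open>C*-algebras of operators and their representations\<close>

text \<open>
  The library type \<^typ>\<open>'h \<Rightarrow>\<^sub>L 'h\<close> consists of the bounded real-linear maps; \<open>B(H)\<close> is its
  subset of complex-linear maps. The operator norm is the same.
\<close>

definition bounded_ops :: "('h::chilbert_space \<Rightarrow>\<^sub>L 'h) set" where
  "bounded_ops = {T :: 'h \<Rightarrow>\<^sub>L 'h. \<forall>c x. T (c *\<^sub>C x) = c *\<^sub>C T x}"

lift_definition scaleC_op :: "complex \<Rightarrow> ('h::chilbert_space \<Rightarrow>\<^sub>L 'h) \<Rightarrow> ('h \<Rightarrow>\<^sub>L 'h)"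
  is "\<lambda>c T x. c *\<^sub>C T x"
  by (rule bounded_linear_compose[OF bounded_linear_scaleC])

text \<open>
  \<open>is_adjoint S T\<close> says \<open>S = T\<^sup>*\<close>. By the Riesz theorem every \<open>T \<in> B(H)\<close> has an adjoint, and it is
  unique, so \<open>\<forall>S. is_adjoint S T \<longrightarrow> \<dots>\<close> below speaks about the adjoint of \<open>T\<close>.
\<close>

definition is_adjoint :: "('h::chilbert_space \<Rightarrow>\<^sub>L 'h) \<Rightarrow> ('h \<Rightarrow>\<^sub>L 'h) \<Rightarrow> bool" where
  "is_adjoint S T \<longleftrightarrow> (\<forall>x y. cinner (T x) y = cinner x (S y))"

definition op_subspace :: "('h::chilbert_space \<Rightarrow>\<^sub>L 'h) set \<Rightarrow> bool" where
  "op_subspace M \<longleftrightarrow>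
     0 \<in> M \<and> (\<forall>S\<in>M. \<forall>T\<in>M. S + T \<in> M) \<and> (\<forall>c. \<forall>T\<in>M. scaleC_op c T \<in> M)"

definition cstar_subalgebra :: "('h::chilbert_space \<Rightarrow>\<^sub>L 'h) set \<Rightarrow> bool" where
  "cstar_subalgebra A \<longleftrightarrow>
     A \<subseteq> bounded_ops \<and> op_subspace A \<and> closed A \<and>
     (\<forall>S\<in>A. \<forall>T\<in>A. S o\<^sub>L T \<in> A) \<and>
     (\<forall>T\<in>A. \<forall>S. is_adjoint S T \<longrightarrow> S \<in> A)"

definition cstar_generated :: "('h::chilbert_space \<Rightarrow>\<^sub>L 'h) set \<Rightarrow> ('h \<Rightarrow>\<^sub>L 'h) set" where
  "cstar_generated G = \<Inter>{A. cstar_subalgebra A \<and> G \<subseteq> A}"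

definition closed_ideal ::
  "('h::chilbert_space \<Rightarrow>\<^sub>L 'h) set \<Rightarrow> ('h \<Rightarrow>\<^sub>L 'h) set \<Rightarrow> bool" where
  "closed_ideal A I \<longleftrightarrow>
     I \<subseteq> A \<and> op_subspace I \<and> closed I \<and>
     (\<forall>S\<in>A. \<forall>T\<in>I. S o\<^sub>L T \<in> I \<and> T o\<^sub>L S \<in> I)"

definition prime_cstar :: "('h::chilbert_space \<Rightarrow>\<^sub>L 'h) set \<Rightarrow> bool" where
  "prime_cstar A \<longleftrightarrow>
     (\<forall>I J. closed_ideal A I \<and> I \<noteq> {0} \<and> closed_ideal A J \<and> J \<noteq> {0} \<longrightarrow> I \<inter> J \<noteq> {0})"

text \<open>Only the values of a representation on \<open>A\<close> matter.\<close>

definition star_representation ::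
  "('h::chilbert_space \<Rightarrow>\<^sub>L 'h) set \<Rightarrow> (('h \<Rightarrow>\<^sub>L 'h) \<Rightarrow> ('k::chilbert_space \<Rightarrow>\<^sub>L 'k)) \<Rightarrow> bool" where
  "star_representation A \<pi> \<longleftrightarrow>
     (\<forall>T\<in>A. \<pi> T \<in> bounded_ops) \<and>
     (\<forall>S\<in>A. \<forall>T\<in>A. \<pi> (S + T) = \<pi> S + \<pi> T) \<and>
     (\<forall>c. \<forall>T\<in>A. \<pi> (scaleC_op c T) = scaleC_op c (\<pi> T)) \<and>
     (\<forall>S\<in>A. \<forall>T\<in>A. \<pi> (S o\<^sub>L T) = \<pi> S o\<^sub>L \<pi> T) \<and>
     (\<forall>S\<in>A. \<forall>T\<in>A. is_adjoint S T \<longrightarrow> is_adjoint (\<pi> S) (\<pi> T))"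

definition closed_csubspace :: "'k::chilbert_space set \<Rightarrow> bool" where
  "closed_csubspace M \<longleftrightarrow>
     0 \<in> M \<and> (\<forall>x\<in>M. \<forall>y\<in>M. x + y \<in> M) \<and> (\<forall>c. \<forall>x\<in>M. c *\<^sub>C x \<in> M) \<and> closed M"

definition irreducible_representation ::
  "('h::chilbert_space \<Rightarrow>\<^sub>L 'h) set \<Rightarrow> (('h \<Rightarrow>\<^sub>L 'h) \<Rightarrow> ('k::chilbert_space \<Rightarrow>\<^sub>L 'k)) \<Rightarrow> bool" where
  "irreducible_representation A \<pi> \<longleftrightarrow>
     star_representation A \<pi> \<and>
     (UNIV :: 'k set) \<noteq> {0} \<and>
     (\<forall>M. closed_csubspace M \<and> (\<forall>T\<in>A. \<forall>x\<in>M. \<pi> T x \<in> M) \<longrightarrow> M = {0} \<or> M = UNIV)"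

text \<open>
  HOL cannot quantify over types inside a formula, so the Hilbert space of the representation is
  a type parameter: an algebra is primitive iff \<open>primitive_on TYPE('k) A\<close> holds for some \<open>'k\<close>.
  A theorem \<open>\<not> primitive_on TYPE('k) A\<close> with a free type variable \<open>'k\<close> therefore says that
  \<open>A\<close> is not primitive.
\<close>

definition primitive_on ::
  "'k::chilbert_space itself \<Rightarrow> ('h::chilbert_space \<Rightarrow>\<^sub>L 'h) set \<Rightarrow> bool" where
  "primitive_on K A \<longleftrightarrow>
     (\<exists>\<pi> :: ('h \<Rightarrow>\<^sub>L 'h) \<Rightarrow> ('k \<Rightarrow>\<^sub>L 'k). irreducible_representation A \<pi> \<and> inj_on \<pi> A)"

definition is_orth_proj :: "('h::chilbert_space \<Rightarrow>\<^sub>L 'h) \<Rightarrow> 'h set \<Rightarrow> bool" where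
  "is_orth_proj P M \<longleftrightarrow> (\<forall>x. P x \<in> M \<and> (\<forall>y\<in>M. cinner (x - P x) y = 0))"

lemma scaleC_op_apply [simp]: "scaleC_op c T x = c *\<^sub>C T x"
  by transfer simp

lemma is_adjoint_bounded_ops:
  assumes "is_adjoint S T"
  shows "S \<in> bounded_ops"
proof -
  have "S (c *\<^sub>C y) = c *\<^sub>C S y" for c y
  proof (rule cinner_left_ext)
    fix x
    have *: "cinner (S y) x = cinner y (T x)" for x y
      using assms unfolding is_adjoint_def by (metis cinner_commute)
    show "cinner (S (c *\<^sub>C y)) x = cinner (c *\<^sub>C S y) x"
      by (simp add: * cinner_scaleC_left)
  qed
  then show ?thesis
    by (simp add: bounded_ops_def)
qed

lemma is_adjoint_unique:
  assumes "is_adjoint S T" "is_adjoint S' T"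
  shows "S = S'"
proof (rule blinfun_eqI, rule cinner_left_ext)
  fix x y
  show "cinner (S y) x = cinner (S' y) x"
    using assms unfolding is_adjoint_def by (metis cinner_commute)
qed

lemma closed_bounded_ops: "closed (bounded_ops :: ('h::chilbert_space \<Rightarrow>\<^sub>L 'h) set)"
proof -
  have closed_eq: "closed {T :: 'h \<Rightarrow>\<^sub>L 'h. T (c *\<^sub>C x) = c *\<^sub>C T x}" for c x
    by (intro closed_Collect_eq continuous_intros
        bounded_linear.continuous_on[OF bounded_linear_scaleC])
  have Inter_eq: "bounded_ops = (\<Inter>c. \<Inter>x. {T :: 'h \<Rightarrow>\<^sub>L 'h. T (c *\<^sub>C x) = c *\<^sub>C T x})"
    by (auto simp: bounded_ops_def)
  show ?thesis
    unfolding Inter_eq by (rule closed_INT, rule ballI, rule closed_INT, rule ballI, rule closed_eq)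
qed

lemma cstar_subalgebra_bounded_ops: "cstar_subalgebra bounded_ops"
  unfolding cstar_subalgebra_def op_subspace_def
  using closed_bounded_ops is_adjoint_bounded_ops
  by (auto simp: bounded_ops_def blinfun.add_left scaleC_add_right scaleC_scaleC mult.commute)

lemma cstar_generated_iff:
  "T \<in> cstar_generated G \<longleftrightarrow> (\<forall>A. cstar_subalgebra A \<and> G \<subseteq> A \<longrightarrow> T \<in> A)"
  by (simp add: cstar_generated_def)

lemma cstar_subalgebra_generated:
  assumes "G \<subseteq> bounded_ops"
  shows "cstar_subalgebra (cstar_generated G)"
  unfolding cstar_subalgebra_def[of "cstar_generated G"] op_subspace_def
proof (intro conjI ballI allI impI)
  show "cstar_generated G \<subseteq> bounded_ops"
    using assms cstar_subalgebra_bounded_ops unfolding cstar_generated_def by blast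
  show "closed (cstar_generated G)"
    unfolding cstar_generated_def by (rule closed_Inter) (simp add: cstar_subalgebra_def)
  show "0 \<in> cstar_generated G"
    unfolding cstar_generated_iff by (simp add: cstar_subalgebra_def op_subspace_def)
next
  fix S T
  assume "S \<in> cstar_generated G" "T \<in> cstar_generated G"
  then show "S + T \<in> cstar_generated G" "S o\<^sub>L T \<in> cstar_generated G"
    unfolding cstar_generated_iff by (simp_all add: cstar_subalgebra_def op_subspace_def)
next
  fix c T
  assume "T \<in> cstar_generated G"
  then show "scaleC_op c T \<in> cstar_generated G"
    unfolding cstar_generated_iff by (simp add: cstar_subalgebra_def op_subspace_def)
next
  fix S T
  assume "T \<in> cstar_generated G" "is_adjoint S T"
  then show "S \<in> cstar_generated G"
    unfolding cstar_generated_iff cstar_subalgebra_def by blast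
qed


section \<open>The Hilbert space \<open>l\<^sup>2(X)\<close>\<close>

typedef 'i ell2 = "{f :: 'i \<Rightarrow> complex. (\<lambda>i. (cmod (f i))\<^sup>2) summable_on UNIV}"
  morphisms ell2_fun Abs_ell2
  by (rule exI[of _ "\<lambda>_. 0"]) simp

setup_lifting type_definition_ell2

lemma ell2_eqI: "(\<And>i. ell2_fun x i = ell2_fun y i) \<Longrightarrow> x = y"
  by (metis ell2_fun_inject ext)

lemma ell2_summable: "(\<lambda>i. (cmod (ell2_fun x i))\<^sup>2) summable_on UNIV"
  using ell2_fun[of x] by simp

lemma square_summable_add:
  assumes "(\<lambda>i. (cmod (f i))\<^sup>2) summable_on UNIV" "(\<lambda>i. (cmod (g i))\<^sup>2) summable_on UNIV"
  shows "(\<lambda>i. (cmod (f i + g i))\<^sup>2) summable_on UNIV"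
proof (rule summable_on_comparison_test)
  show "(\<lambda>i. 2 * (cmod (f i))\<^sup>2 + 2 * (cmod (g i))\<^sup>2) summable_on UNIV"
    using assms by (intro summable_on_add summable_on_cmult_right)
  show "(cmod (f i + g i))\<^sup>2 \<le> 2 * (cmod (f i))\<^sup>2 + 2 * (cmod (g i))\<^sup>2" for i
  proof -
    have "(cmod (f i + g i))\<^sup>2 \<le> (cmod (f i) + cmod (g i))\<^sup>2"
      by (rule power_mono[OF norm_triangle_ineq]) simp
    also have "\<dots> \<le> 2 * (cmod (f i))\<^sup>2 + 2 * (cmod (g i))\<^sup>2"
      using zero_le_power2[of "cmod (f i) - cmod (g i)"]
      by (simp add: power2_eq_square algebra_simps)
    finally show ?thesis .
  qed
qed simp

lemma square_summable_mult:
  assumes "(\<lambda>i. (cmod (f i))\<^sup>2) summable_on UNIV"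
  shows "(\<lambda>i. (cmod (c * f i))\<^sup>2) summable_on UNIV"
  using assms by (simp add: norm_mult power_mult_distrib summable_on_cmult_right)

instantiation ell2 :: (type) ab_group_add
begin

lift_definition zero_ell2 :: "'a ell2" is "\<lambda>_. 0"
  by simp

lift_definition plus_ell2 :: "'a ell2 \<Rightarrow> 'a ell2 \<Rightarrow> 'a ell2" is "\<lambda>f g i. f i + g i"
  by (rule square_summable_add)

lift_definition uminus_ell2 :: "'a ell2 \<Rightarrow> 'a ell2" is "\<lambda>f i. - f i"
  by simp

lift_definition minus_ell2 :: "'a ell2 \<Rightarrow> 'a ell2 \<Rightarrow> 'a ell2" is "\<lambda>f g i. f i - g i"
  using square_summable_add[of _ "\<lambda>i. - _ i"] by simp

instance
  by standard (transfer; simp add: fun_eq_iff)+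

end

instantiation ell2 :: (type) real_normed_vector
begin

lift_definition scaleR_ell2 :: "real \<Rightarrow> 'a ell2 \<Rightarrow> 'a ell2" is "\<lambda>t f i. complex_of_real t * f i"
  by (rule square_summable_mult)

lift_definition norm_ell2 :: "'a ell2 \<Rightarrow> real" is "\<lambda>f. sqrt (\<Sum>\<^sub>\<infinity>i. (cmod (f i))\<^sup>2)" .

definition sgn_ell2 :: "'a ell2 \<Rightarrow> 'a ell2" where
  "sgn_ell2 x = inverse (norm x) *\<^sub>R x"

definition dist_ell2 :: "'a ell2 \<Rightarrow> 'a ell2 \<Rightarrow> real" where
  "dist_ell2 x y = norm (x - y)"

definition uniformity_ell2 :: "('a ell2 \<times> 'a ell2) filter" where
  "uniformity_ell2 = (INF e\<in>{0<..}. principal {(x, y). dist x y < e})"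

definition open_ell2 :: "'a ell2 set \<Rightarrow> bool" where
  "open_ell2 U = (\<forall>x\<in>U. \<forall>\<^sub>F (x', y) in uniformity. x' = x \<longrightarrow> y \<in> U)"

lemma L2_set_le_norm_ell2:
  assumes "finite F"
  shows "L2_set (\<lambda>i. cmod (ell2_fun x i)) F \<le> norm (x :: 'a ell2)"
  unfolding L2_set_def norm_ell2.rep_eq
  using assms ell2_summable by (intro real_sqrt_le_mono finite_sum_le_infsum) auto

lemma norm_ell2_le:
  fixes x :: "'a ell2"
  assumes "\<And>F. finite F \<Longrightarrow> L2_set (\<lambda>i. cmod (ell2_fun x i)) F \<le> b"
  shows "norm x \<le> b"
proof -
  have b: "0 \<le> b"
    using assms[of "{}"] by simp
  have "(\<Sum>i\<in>F. (cmod (ell2_fun x i))\<^sup>2) \<le> b\<^sup>2" if "finite F" for F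
    using assms[OF that] unfolding L2_set_def by (rule sqrt_le_D)
  then have "(\<Sum>\<^sub>\<infinity>i. (cmod (ell2_fun x i))\<^sup>2) \<le> b\<^sup>2"
    using ell2_summable by (intro infsum_le_finite_sums) auto
  then show ?thesis
    unfolding norm_ell2.rep_eq using b by (simp add: real_le_lsqrt)
qed

instance
proof
  fix x y :: "'a ell2" and s t :: real
  show "dist x y = norm (x - y)"
    by (simp add: dist_ell2_def)
  show "sgn x = inverse (norm x) *\<^sub>R x"
    by (simp add: sgn_ell2_def)
  show "uniformity = (INF e\<in>{0<..}. principal {(x :: 'a ell2, y). dist x y < e})"
    by (simp add: uniformity_ell2_def)
  show "open U \<longleftrightarrow> (\<forall>x\<in>U. \<forall>\<^sub>F (x', y) in uniformity. x' = x \<longrightarrow> y \<in> U)" for U :: "'a ell2 set"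
    by (simp add: open_ell2_def)
  show "s *\<^sub>R (x + y) = s *\<^sub>R x + s *\<^sub>R y" "(s + t) *\<^sub>R x = s *\<^sub>R x + t *\<^sub>R x"
    "s *\<^sub>R t *\<^sub>R x = (s * t) *\<^sub>R x" "1 *\<^sub>R x = x"
    by (transfer; simp add: fun_eq_iff algebra_simps)+
  have coord: "cmod (ell2_fun x i) \<le> norm x" for i
    using L2_set_le_norm_ell2[of "{i}" x] by simp
  show "norm x = 0 \<longleftrightarrow> x = 0"
  proof
    assume "norm x = 0"
    then show "x = 0"
      using coord by (intro ell2_eqI) (simp add: zero_ell2.rep_eq)
  next
    assume "x = 0"
    then show "norm x = 0"
      by (simp add: norm_ell2.rep_eq zero_ell2.rep_eq)
  qed
  show "norm (x + y) \<le> norm x + norm y"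
  proof (rule norm_ell2_le)
    fix F :: "'a set"
    assume F: "finite F"
    have "L2_set (\<lambda>i. cmod (ell2_fun (x + y) i)) F
        \<le> L2_set (\<lambda>i. cmod (ell2_fun x i) + cmod (ell2_fun y i)) F"
      by (rule L2_set_mono) (auto simp: plus_ell2.rep_eq norm_triangle_ineq)
    also have "\<dots> \<le> L2_set (\<lambda>i. cmod (ell2_fun x i)) F + L2_set (\<lambda>i. cmod (ell2_fun y i)) F"
      by (rule L2_set_triangle_ineq)
    also have "\<dots> \<le> norm x + norm y"
      by (intro add_mono L2_set_le_norm_ell2 F)
    finally show "L2_set (\<lambda>i. cmod (ell2_fun (x + y) i)) F \<le> norm x + norm y" .
  qed
  have "(\<Sum>\<^sub>\<infinity>i. (cmod (complex_of_real s * ell2_fun x i))\<^sup>2)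
      = s\<^sup>2 * (\<Sum>\<^sub>\<infinity>i. (cmod (ell2_fun x i))\<^sup>2)"
    by (simp add: norm_mult power_mult_distrib infsum_cmult_right')
  then show "norm (s *\<^sub>R x) = \<bar>s\<bar> * norm x"
    by (simp add: norm_ell2.rep_eq scaleR_ell2.rep_eq real_sqrt_mult)
qed

end

lemma norm_ell2_coord: "cmod (ell2_fun x i) \<le> norm x"
  using L2_set_le_norm_ell2[of "{i}" x] by simp

lemma square_summable_if_L2_set_le:
  fixes f :: "'i \<Rightarrow> complex"
  assumes "\<And>F. finite F \<Longrightarrow> L2_set (\<lambda>i. cmod (f i)) F \<le> b"
  shows "(\<lambda>i. (cmod (f i))\<^sup>2) summable_on UNIV"
proof (rule nonneg_bdd_above_summable_on)
  show "bdd_above (sum (\<lambda>i. (cmod (f i))\<^sup>2) ` {F. F \<subseteq> UNIV \<and> finite F})"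
  proof (rule bdd_aboveI2)
    fix F :: "'i set"
    assume "F \<in> {F. F \<subseteq> UNIV \<and> finite F}"
    then show "(\<Sum>i\<in>F. (cmod (f i))\<^sup>2) \<le> b\<^sup>2"
      using assms[of F] unfolding L2_set_def by (simp add: sqrt_le_D)
  qed
qed simp

instance ell2 :: (type) banach
proof
  fix X :: "nat \<Rightarrow> 'a ell2"
  assume "Cauchy X"
  then have X: "\<exists>N. \<forall>m\<ge>N. \<forall>n\<ge>N. norm (X m - X n) < e" if "0 < e" for e
    using that unfolding Cauchy_iff by blast
  have "Cauchy (\<lambda>n. ell2_fun (X n) i)" for i
  proof (rule CauchyI)
    fix e :: real
    assume "0 < e"
    then obtain N where N: "\<forall>m\<ge>N. \<forall>n\<ge>N. norm (X m - X n) < e"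
      using X by blast
    have "norm (ell2_fun (X m) i - ell2_fun (X n) i) < e" if "N \<le> m" "N \<le> n" for m n
    proof -
      have "norm (ell2_fun (X m) i - ell2_fun (X n) i) \<le> norm (X m - X n)"
        using norm_ell2_coord[of "X m - X n" i] by (simp add: minus_ell2.rep_eq)
      also have "\<dots> < e"
        using N that by blast
      finally show ?thesis .
    qed
    then show "\<exists>N. \<forall>m\<ge>N. \<forall>n\<ge>N. norm (ell2_fun (X m) i - ell2_fun (X n) i) < e"
      by blast
  qed
  then have "\<forall>i. \<exists>l. (\<lambda>n. ell2_fun (X n) i) \<longlonglongrightarrow> l"
    using Cauchy_convergent[where 'a = complex] by (simp add: convergent_def)
  from choice[OF this] obtain L where "\<forall>i. (\<lambda>n. ell2_fun (X n) i) \<longlonglongrightarrow> L i" ..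
  then have L: "(\<lambda>n. ell2_fun (X n) i) \<longlonglongrightarrow> L i" for i ..
  have bound: "\<exists>N. \<forall>m\<ge>N. \<forall>F. finite F \<longrightarrow> L2_set (\<lambda>i. cmod (ell2_fun (X m) i - L i)) F \<le> e"
    if "0 < e" for e
  proof -
    obtain N where N: "\<forall>m\<ge>N. \<forall>n\<ge>N. norm (X m - X n) < e"
      using X[OF \<open>0 < e\<close>] by blast
    have "L2_set (\<lambda>i. cmod (ell2_fun (X m) i - L i)) F \<le> e" if "N \<le> m" "finite F" for m F
    proof (rule tendsto_upperbound)
      show "(\<lambda>n. L2_set (\<lambda>i. cmod (ell2_fun (X m) i - ell2_fun (X n) i)) F)
          \<longlonglongrightarrow> L2_set (\<lambda>i. cmod (ell2_fun (X m) i - L i)) F"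
        unfolding L2_set_def by (intro tendsto_intros L)
      show "\<forall>\<^sub>F n in sequentially. L2_set (\<lambda>i. cmod (ell2_fun (X m) i - ell2_fun (X n) i)) F \<le> e"
        using eventually_ge_at_top[of N]
      proof eventually_elim
        case (elim n)
        then have "norm (X m - X n) < e"
          using N \<open>N \<le> m\<close> by blast
        then show ?case
          using L2_set_le_norm_ell2[OF \<open>finite F\<close>, of "X m - X n"]
          by (simp add: minus_ell2.rep_eq)
      qed
    qed simp
    then show ?thesis
      by blast
  qed
  obtain N where "\<forall>F. finite F \<longrightarrow> L2_set (\<lambda>i. cmod (ell2_fun (X N) i - L i)) F \<le> 1"
    using bound[of 1] by auto
  then have "(\<lambda>i. (cmod (ell2_fun (X N) i - L i))\<^sup>2) summable_on UNIV"
    by (intro square_summable_if_L2_set_le) auto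
  then have "(\<lambda>i. (cmod (ell2_fun (X N) i + (-1) * (ell2_fun (X N) i - L i)))\<^sup>2) summable_on UNIV"
    by (intro square_summable_add square_summable_mult ell2_summable)
  then have "L \<in> {f. (\<lambda>i. (cmod (f i))\<^sup>2) summable_on UNIV}"
    by simp
  then obtain l where l: "ell2_fun l = L"
    using Abs_ell2_inverse by blast
  have "X \<longlonglongrightarrow> l"
  proof (rule LIMSEQ_I)
    fix e :: real
    assume "0 < e"
    then obtain N where N: "\<forall>m\<ge>N. \<forall>F. finite F \<longrightarrow> L2_set (\<lambda>i. cmod (ell2_fun (X m) i - L i)) F \<le> e / 2"
      using bound[of "e / 2"] by auto
    have "norm (X m - l) < e" if "N \<le> m" for m
    proof -
      have "norm (X m - l) \<le> e / 2"
        using N that by (intro norm_ell2_le) (simp add: minus_ell2.rep_eq l)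
      then show ?thesis
        using \<open>0 < e\<close> by simp
    qed
    then show "\<exists>N. \<forall>m\<ge>N. norm (X m - l) < e"
      by blast
  qed
  then show "convergent X"
    by (auto simp: convergent_def)
qed

lemma ell2_product_summable: "(\<lambda>i. ell2_fun x i * cnj (ell2_fun y i)) summable_on UNIV"
proof (rule abs_summable_summable, rule summable_on_comparison_test)
  show "(\<lambda>i. (cmod (ell2_fun x i))\<^sup>2 + (cmod (ell2_fun y i))\<^sup>2) summable_on UNIV"
    by (intro summable_on_add ell2_summable)
  show "norm (ell2_fun x i * cnj (ell2_fun y i)) \<le> (cmod (ell2_fun x i))\<^sup>2 + (cmod (ell2_fun y i))\<^sup>2"
    for i
  proof -
    have "0 \<le> cmod (ell2_fun x i) * cmod (ell2_fun y i)"
      by simp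
    then show ?thesis
      using sum_squares_bound[of "cmod (ell2_fun x i)" "cmod (ell2_fun y i)"]
      unfolding norm_mult complex_mod_cnj by linarith
  qed
qed simp

instantiation ell2 :: (type) chilbert_space
begin

lift_definition scaleC_ell2 :: "complex \<Rightarrow> 'a ell2 \<Rightarrow> 'a ell2" is "\<lambda>c f i. c * f i"
  by (rule square_summable_mult)

definition cinner_ell2 :: "'a ell2 \<Rightarrow> 'a ell2 \<Rightarrow> complex" where
  "cinner_ell2 x y = (\<Sum>\<^sub>\<infinity>i. ell2_fun x i * cnj (ell2_fun y i))"

instance
proof
  fix x y z :: "'a ell2" and c d :: complex and t :: real
  show "c *\<^sub>C (x + y) = c *\<^sub>C x + c *\<^sub>C y" "(c + d) *\<^sub>C x = c *\<^sub>C x + d *\<^sub>C x"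
    "c *\<^sub>C d *\<^sub>C x = (c * d) *\<^sub>C x" "t *\<^sub>R x = complex_of_real t *\<^sub>C x"
    by (transfer; simp add: fun_eq_iff algebra_simps)+
  show "cinner x y = cnj (cinner y x)"
    unfolding cinner_ell2_def infsum_cnj[symmetric] by (simp add: mult.commute)
  show "cinner (x + y) z = cinner x z + cinner y z"
    unfolding cinner_ell2_def
    by (simp add: plus_ell2.rep_eq distrib_right infsum_add ell2_product_summable)
  show "cinner (c *\<^sub>C x) y = c * cinner x y"
    unfolding cinner_ell2_def
    by (simp add: scaleC_ell2.rep_eq mult.assoc infsum_cmult_right')
  have "((\<lambda>i. complex_of_real ((cmod (ell2_fun x i))\<^sup>2)) has_sum
      complex_of_real (\<Sum>\<^sub>\<infinity>i. (cmod (ell2_fun x i))\<^sup>2)) UNIV"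
    by (intro has_sum_of_real has_sum_infsum ell2_summable)
  then have "cinner x x = complex_of_real (\<Sum>\<^sub>\<infinity>i. (cmod (ell2_fun x i))\<^sup>2)"
    unfolding cinner_ell2_def complex_norm_square[symmetric] by (rule infsumI)
  then show "cinner x x = complex_of_real ((norm x)\<^sup>2)"
    by (simp add: norm_ell2.rep_eq infsum_nonneg)
qed

end

text \<open>The subspace \<open>l\<^sup>2(S) \<subseteq> l\<^sup>2(X)\<close> for \<open>S \<subseteq> X\<close>.\<close>

definition ell2_on :: "'i set \<Rightarrow> 'i ell2 set" where
  "ell2_on S = {\<xi>. \<forall>x. x \<notin> S \<longrightarrow> ell2_fun \<xi> x = 0}"

definition ell2_indicator :: "'i \<Rightarrow> 'i ell2" where
  "ell2_indicator i = Abs_ell2 (\<lambda>j. if j = i then 1 else 0)"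

lemma ell2_indicator_apply [simp]: "ell2_fun (ell2_indicator i) j = (if j = i then 1 else 0)"
proof -
  have "(\<lambda>j. (cmod (if j = i then 1 else 0))\<^sup>2) summable_on UNIV"
    by (rule finite_nonzero_values_imp_summable_on) (rule finite_subset[of _ "{i}"], auto)
  then show ?thesis
    by (simp add: ell2_indicator_def Abs_ell2_inverse)
qed

lemma cinner_ell2_indicator: "cinner \<xi> (ell2_indicator i) = ell2_fun \<xi> i"
proof -
  have "cinner \<xi> (ell2_indicator i) = (\<Sum>\<^sub>\<infinity>j\<in>{i}. ell2_fun \<xi> j * cnj (ell2_fun (ell2_indicator i) j))"
    unfolding cinner_ell2_def by (rule infsum_cong_neutral) auto
  then show ?thesis
    by simp
qed

lemma ell2_orthogonal_on:
  assumes "\<forall>\<eta>\<in>ell2_on S. cinner \<xi> \<eta> = 0" and "x \<in> S"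
  shows "ell2_fun \<xi> x = 0"
proof -
  have "ell2_indicator x \<in> ell2_on S"
    using \<open>x \<in> S\<close> by (auto simp: ell2_on_def)
  then show ?thesis
    using assms(1) cinner_ell2_indicator by metis
qed

lemma ell2_partial_composition:
  assumes "inj_on g S"
  shows "\<exists>T\<in>bounded_ops. \<forall>\<xi> x. ell2_fun (blinfun_apply T \<xi>) x = (if x \<in> S then ell2_fun \<xi> (g x) else 0)"
proof -
  define h :: "'a ell2 \<Rightarrow> 'a \<Rightarrow> complex" where
    "h \<xi> x = (if x \<in> S then ell2_fun \<xi> (g x) else 0)" for \<xi> x
  have bound: "L2_set (\<lambda>x. cmod (h \<xi> x)) F \<le> norm \<xi>" if "finite F" for \<xi> F
  proof -
    have "(\<Sum>x\<in>F. (cmod (h \<xi> x))\<^sup>2) = (\<Sum>x\<in>F \<inter> S. (cmod (ell2_fun \<xi> (g x)))\<^sup>2)"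
      using that by (intro sum.mono_neutral_cong_right) (auto simp: h_def)
    also have "\<dots> = (\<Sum>y\<in>g ` (F \<inter> S). (cmod (ell2_fun \<xi> y))\<^sup>2)"
      by (subst sum.reindex) (auto intro: inj_on_subset[OF assms])
    finally have "L2_set (\<lambda>x. cmod (h \<xi> x)) F = L2_set (\<lambda>y. cmod (ell2_fun \<xi> y)) (g ` (F \<inter> S))"
      by (simp add: L2_set_def)
    then show ?thesis
      using that by (simp add: L2_set_le_norm_ell2)
  qed
  define T where "T \<xi> = Abs_ell2 (h \<xi>)" for \<xi>
  have T: "ell2_fun (T \<xi>) = h \<xi>" for \<xi>
    unfolding T_def using square_summable_if_L2_set_le[OF bound] by (simp add: Abs_ell2_inverse)
  have "bounded_linear T"
  proof (rule bounded_linear_intro[where K = 1])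
    show "T (\<xi> + \<eta>) = T \<xi> + T \<eta>" for \<xi> \<eta>
      by (rule ell2_eqI) (simp add: T h_def plus_ell2.rep_eq)
    show "T (t *\<^sub>R \<xi>) = t *\<^sub>R T \<xi>" for t \<xi>
      by (rule ell2_eqI) (simp add: T h_def scaleR_ell2.rep_eq)
    show "norm (T \<xi>) \<le> norm \<xi> * 1" for \<xi>
      using bound by (simp add: norm_ell2_le T)
  qed
  then have apply_T: "blinfun_apply (Blinfun T) = T"
    by (rule bounded_linear_Blinfun_apply)
  have "T (c *\<^sub>C \<xi>) = c *\<^sub>C T \<xi>" for c \<xi>
    by (rule ell2_eqI) (simp add: T h_def scaleC_ell2.rep_eq)
  then have "Blinfun T \<in> bounded_ops"
    by (simp add: bounded_ops_def apply_T)
  then show ?thesis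
    by (intro bexI[of _ "Blinfun T"]) (simp_all add: apply_T T h_def)
qed


section \<open>The projections \<open>P\<^sub>a\<close> and the partial isometries \<open>V\<^sub>a\<^sub>b\<close>\<close>

text \<open>
  Sequences and tuples are indexed from 0: a tuple of length \<open>n\<close> is a real list of length \<open>n\<close>,
  and its \<open>n\<close>-th entry is the list entry with index \<open>n - 1\<close>.
\<close>

type_synonym sequences = "nat \<Rightarrow> real"
type_synonym operator = "sequences ell2 \<Rightarrow>\<^sub>L sequences ell2"

definition extends :: "real list \<Rightarrow> real list \<Rightarrow> bool" where
  "extends a b \<longleftrightarrow> length b \<le> length a \<and> (\<forall>i<length b. a ! i = b ! i)"

definition cyl :: "real list \<Rightarrow> sequences set" where
  "cyl a = {x. \<forall>i<length a. x i = a ! i}"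

definition cyl_proj :: "real list \<Rightarrow> operator" where
  "cyl_proj a = (THE P. is_orth_proj P (ell2_on (cyl a)))"

definition overwrite :: "real list \<Rightarrow> sequences \<Rightarrow> sequences" where
  "overwrite a x = (\<lambda>i. if i < length a then a ! i else x i)"

definition cyl_isometry :: "real list \<Rightarrow> real list \<Rightarrow> operator" where
  "cyl_isometry a b = (THE V.
     (\<forall>\<xi>\<in>ell2_on (cyl a). \<forall>x.
        ell2_fun (blinfun_apply V \<xi>) x = (if x \<in> cyl b then ell2_fun \<xi> (overwrite a x) else 0)) \<and>
     (\<forall>\<xi>. (\<forall>\<eta>\<in>ell2_on (cyl a). cinner \<xi> \<eta> = 0) \<longrightarrow> blinfun_apply V \<xi> = 0))"

definition cyl_projs :: "operator set" where
  "cyl_projs = {cyl_proj a | a. 1 \<le> length a}"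

lemma bij_betw_overwrite:
  assumes "length a = length b"
  shows "bij_betw (overwrite a) (cyl b) (cyl a)"
proof (rule bij_betw_byWitness[where f' = "overwrite b"])
  show "\<forall>x\<in>cyl b. overwrite b (overwrite a x) = x" "\<forall>x\<in>cyl a. overwrite a (overwrite b x) = x"
    using assms by (auto simp: overwrite_def cyl_def fun_eq_iff)
  show "overwrite a ` cyl b \<subseteq> cyl a" "overwrite b ` cyl a \<subseteq> cyl b"
    by (auto simp: overwrite_def cyl_def)
qed

lemma cyl_proj_props:
  shows is_orth_proj_cyl_proj: "is_orth_proj (cyl_proj a) (ell2_on (cyl a))"
    and cyl_proj_apply:
      "ell2_fun (blinfun_apply (cyl_proj a) \<xi>) x = (if x \<in> cyl a then ell2_fun \<xi> x else 0)"
    and cyl_proj_bounded_ops: "cyl_proj a \<in> bounded_ops"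
proof -
  obtain T where T: "T \<in> bounded_ops"
    "\<forall>\<xi> x. ell2_fun (blinfun_apply T \<xi>) x = (if x \<in> cyl a then ell2_fun \<xi> x else 0)"
    using ell2_partial_composition[of "\<lambda>x. x" "cyl a"] by auto
  have proj: "is_orth_proj T (ell2_on (cyl a))"
    unfolding is_orth_proj_def
  proof (intro allI conjI ballI)
    fix \<xi> \<eta>
    show "blinfun_apply T \<xi> \<in> ell2_on (cyl a)"
      using T by (auto simp: ell2_on_def)
    assume "\<eta> \<in> ell2_on (cyl a)"
    then have "ell2_fun (\<xi> - blinfun_apply T \<xi>) x * cnj (ell2_fun \<eta> x) = 0" for x
      using T by (auto simp: ell2_on_def minus_ell2.rep_eq)
    then show "cinner (\<xi> - blinfun_apply T \<xi>) \<eta> = 0"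
      unfolding cinner_ell2_def by (simp only: infsum_0_simp)
  qed
  have uniq: "P = T" if P: "is_orth_proj P (ell2_on (cyl a))" for P
  proof (intro blinfun_eqI ell2_eqI)
    fix \<xi> x
    show "ell2_fun (blinfun_apply P \<xi>) x = ell2_fun (blinfun_apply T \<xi>) x"
    proof (cases "x \<in> cyl a")
      case True
      then have "ell2_fun (\<xi> - blinfun_apply P \<xi>) x = 0"
        using P by (intro ell2_orthogonal_on) (auto simp: is_orth_proj_def)
      then show ?thesis
        using True T by (simp add: minus_ell2.rep_eq)
    next
      case False
      then show ?thesis
        using P T by (auto simp: is_orth_proj_def ell2_on_def)
    qed
  qed
  have "cyl_proj a = T"
    unfolding cyl_proj_def using proj uniq by (rule the_equality)
  then show "is_orth_proj (cyl_proj a) (ell2_on (cyl a))" "cyl_proj a \<in> bounded_ops"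
    "ell2_fun (blinfun_apply (cyl_proj a) \<xi>) x = (if x \<in> cyl a then ell2_fun \<xi> x else 0)"
    using proj T by auto
qed

lemma cyl_isometry_props:
  assumes "length a = length b"
  shows cyl_isometry_apply: "ell2_fun (blinfun_apply (cyl_isometry a b) \<xi>) x =
      (if x \<in> cyl b then ell2_fun \<xi> (overwrite a x) else 0)"
    and cyl_isometry_bounded_ops: "cyl_isometry a b \<in> bounded_ops"
proof -
  define spec where "spec V \<longleftrightarrow>
     (\<forall>\<xi>\<in>ell2_on (cyl a). \<forall>x.
        ell2_fun (blinfun_apply V \<xi>) x = (if x \<in> cyl b then ell2_fun \<xi> (overwrite a x) else 0)) \<and>
     (\<forall>\<xi>. (\<forall>\<eta>\<in>ell2_on (cyl a). cinner \<xi> \<eta> = 0) \<longrightarrow> blinfun_apply V \<xi> = 0)" for V :: operator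
  obtain T where T: "T \<in> bounded_ops" "\<forall>\<xi> x. ell2_fun (blinfun_apply T \<xi>) x =
      (if x \<in> cyl b then ell2_fun \<xi> (overwrite a x) else 0)"
    using ell2_partial_composition[OF bij_betw_imp_inj_on[OF bij_betw_overwrite[OF assms]]] by auto
  have "overwrite a x \<in> cyl a" for x
    by (simp add: overwrite_def cyl_def)
  then have "blinfun_apply T \<xi> = 0" if "\<forall>\<eta>\<in>ell2_on (cyl a). cinner \<xi> \<eta> = 0" for \<xi>
    using ell2_orthogonal_on[OF that] T by (intro ell2_eqI) (simp add: zero_ell2.rep_eq)
  then have "spec T"
    using T by (simp add: spec_def)
  have uniq: "V = T" if V: "spec V" for V
  proof (rule blinfun_eqI)
    fix \<xi>
    define \<eta> where "\<eta> = blinfun_apply (cyl_proj a) \<xi>"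
    have \<eta>: "\<eta> \<in> ell2_on (cyl a)" "\<forall>\<zeta>\<in>ell2_on (cyl a). cinner (\<xi> - \<eta>) \<zeta> = 0"
      using is_orth_proj_cyl_proj[of a] by (simp_all add: is_orth_proj_def \<eta>_def)
    have "blinfun_apply V (\<xi> - \<eta>) = 0" "blinfun_apply T (\<xi> - \<eta>) = 0"
      using \<eta>(2) V \<open>spec T\<close> unfolding spec_def by blast+
    moreover have "blinfun_apply V \<eta> = blinfun_apply T \<eta>"
      using \<eta>(1) V \<open>spec T\<close> unfolding spec_def by (intro ell2_eqI) simp
    ultimately show "blinfun_apply V \<xi> = blinfun_apply T \<xi>"
      by (simp add: blinfun.diff_right)
  qed
  have "cyl_isometry a b = T"
    unfolding cyl_isometry_def spec_def[symmetric] using \<open>spec T\<close> uniq by (rule the_equality)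
  then show "cyl_isometry a b \<in> bounded_ops" "ell2_fun (blinfun_apply (cyl_isometry a b) \<xi>) x =
      (if x \<in> cyl b then ell2_fun \<xi> (overwrite a x) else 0)"
    using T by auto
qed

lemma inj_cyl_proj: "inj cyl_proj"
proof (rule injI)
  fix a b :: "real list"
  assume eq: "cyl_proj a = cyl_proj b"
  have cyl_eq: "x \<in> cyl a \<longleftrightarrow> x \<in> cyl b" for x
    using cyl_proj_apply[of a "ell2_indicator x" x] cyl_proj_apply[of b "ell2_indicator x" x] eq
    by (auto split: if_splits)
  have in_cyl: "overwrite c x \<in> cyl c" for c x
    by (simp add: cyl_def overwrite_def)
  have ab: "overwrite a x \<in> cyl b" for x
    using cyl_eq in_cyl by blast
  have ba: "overwrite b x \<in> cyl a" for x
    using cyl_eq in_cyl by blast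
  have le: "length d \<le> length c" if "\<And>x. overwrite c x \<in> cyl d" for c d
  proof (rule ccontr)
    assume "\<not> length d \<le> length c"
    then have "overwrite c (\<lambda>_. d ! length c + 1) (length c) = d ! length c"
      using that[of "\<lambda>_. d ! length c + 1"] by (simp add: cyl_def)
    then show False
      by (simp add: overwrite_def)
  qed
  have "length a = length b"
    using le[OF ab] le[OF ba] by simp
  then show "a = b"
    using ab[of "\<lambda>_. 0"] by (intro nth_equalityI) (auto simp: cyl_def overwrite_def)
qed


section \<open>The transfinite construction\<close>

text \<open>
  \<open>r\<close> is a well-order of the least order type of cardinality \<open>2\<^bsup>\<aleph>\<^sub>0\<^esup>\<close>; the elements of its field
  play the role of the ordinals below \<open>2\<^bsup>\<aleph>\<^sub>0\<^esup>\<close>.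
\<close>

definition below :: "'i rel \<Rightarrow> 'i \<Rightarrow> 'i set" where
  "below r \<sigma> = {\<tau>. (\<tau>, \<sigma>) \<in> r \<and> \<tau> \<noteq> \<sigma>}"

definition S_set ::
  "'i rel \<Rightarrow> ('i \<Rightarrow> nat) \<Rightarrow> ('i \<Rightarrow> real list) \<Rightarrow> ('i \<Rightarrow> real list) \<Rightarrow> 'i \<Rightarrow> real set" where
  "S_set r n a b \<sigma> =
     {a \<tau> ! (n \<sigma> - 1) | \<tau>. \<tau> \<in> below r \<sigma> \<and> n \<sigma> \<le> n \<tau>} \<union>
     {b \<tau> ! (n \<sigma> - 1) | \<tau>. \<tau> \<in> below r \<sigma> \<and> n \<sigma> \<le> n \<tau>}"

definition T_set :: "'i rel \<Rightarrow> ('i \<Rightarrow> operator set) \<Rightarrow> ('i \<Rightarrow> nat) \<Rightarrow> 'i \<Rightarrow> real set" where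
  "T_set r \<phi>\<^sub>2 n \<sigma> =
     {c ! (n \<sigma> - 1) | c \<tau>. \<tau> \<in> below r \<sigma> \<and> cyl_proj c \<in> \<phi>\<^sub>2 \<tau> \<and> n \<sigma> \<le> length c}"

locale transfinite_construction =
  fixes r :: "'i rel"
    and \<phi>\<^sub>1 :: "'i \<Rightarrow> operator \<times> operator"
    and \<phi>\<^sub>2 :: "'i \<Rightarrow> operator set"
    and n :: "'i \<Rightarrow> nat"
    and a b :: "'i \<Rightarrow> real list"
  assumes card_order: "Card_order r"
    and card_continuum: "(r, card_of (UNIV :: real set)) \<in> ordIso"
    and bij_\<phi>\<^sub>1: "bij_betw \<phi>\<^sub>1 (Field r) (cyl_projs \<times> cyl_projs)"
    and bij_\<phi>\<^sub>2: "bij_betw \<phi>\<^sub>2 (Field r) {Z. Z \<subseteq> cyl_projs \<and> countable Z}"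
    and step: "\<sigma> \<in> Field r \<Longrightarrow>
      \<exists>a' b' t.
        1 \<le> length a' \<and> 1 \<le> length b' \<and>
        \<phi>\<^sub>1 \<sigma> = (cyl_proj a', cyl_proj b') \<and>
        n \<sigma> = max (length a') (length b') + 1 \<and>
        t \<notin> S_set r n a b \<sigma> \<union> T_set r \<phi>\<^sub>2 n \<sigma> \<and>
        length (a \<sigma>) = n \<sigma> \<and> extends (a \<sigma>) a' \<and> a \<sigma> ! (n \<sigma> - 1) = t \<and>
        length (b \<sigma>) = n \<sigma> \<and> extends (b \<sigma>) b' \<and> b \<sigma> ! (n \<sigma> - 1) = t"

definition isometries ::
  "'i rel \<Rightarrow> ('i \<Rightarrow> real list) \<Rightarrow> ('i \<Rightarrow> real list) \<Rightarrow> operator set" where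
  "isometries r a b = {cyl_isometry (a \<sigma>) (b \<sigma>) | \<sigma>. \<sigma> \<in> Field r}"

end

theory Submission
  imports Defs
begin

text \<open>
  Call two tuples linked if finitely many exchanges of an initial segment \<open>a\<^sub>\<sigma>\<close> for \<open>b\<^sub>\<sigma>\<close>, or of
  \<open>b\<^sub>\<sigma>\<close> for \<open>a\<^sub>\<sigma>\<close>, lead from one to the other. A product of two of the partial isometries
  \<open>V\<^sub>d\<^sub>e\<close> with \<open>d\<close> and \<open>e\<close> linked is zero or again of this form, because linkedness survives
  appending a common tail. The adjoint of \<open>V\<^sub>d\<^sub>e\<close> is \<open>V\<^sub>e\<^sub>d\<close>. So the linear span of these isometries
  is a *-algebra, and the algebra \<open>\<A>\<close> of the theorem is its closure (\<open>alg_subset_closure\<close>).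

  Primeness. If \<open>I\<close> is a nonzero closed ideal, it contains some \<open>R = T T\<^sup>*\<close> with a diagonal matrix
  coefficient \<open>l > 0\<close> at some sequence \<open>x\<close>. Approximate \<open>R\<close> by an element \<open>B\<close> of the span. Once \<open>c\<close>
  is an initial segment of \<open>x\<close> at least as long as all tuples that occur in \<open>B\<close>, the compression
  \<open>P\<^sub>c B P\<^sub>c\<close> is a scalar multiple of \<open>P\<^sub>c\<close>, and the scalar is close to \<open>l\<close>. Hence \<open>P\<^sub>c\<close> is at
  distance less than 1 from \<open>I\<close>, and a projection with this property lies in \<open>I\<close>
  (\<open>closed_ideal_contains_cyl_proj\<close>). If now \<open>P\<^sub>c \<in> I\<close> and \<open>P\<^sub>d \<in> J\<close>, then the construction
  extends \<open>c\<close> and \<open>d\<close> to some \<open>a\<^sub>\<sigma>\<close> and \<open>b\<^sub>\<sigma>\<close>, whose projections are equivalent through \<open>V\<^sub>\<sigma>\<close>.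
  So \<open>P\<close> of \<open>b\<^sub>\<sigma>\<close> lies in both ideals.

  Failure of primitivity. Let \<open>\<pi>\<close> be a faithful irreducible representation and \<open>v\<close> a vector that
  some \<open>\<pi>(P\<^sub>c)\<close> does not annihilate. Projections for different tuples of the same length are
  orthogonal, so only countably many \<open>P\<^sub>c\<close> satisfy \<open>\<pi>(P\<^sub>c) v \<noteq> 0\<close>. They form a set
  \<open>\<phi>\<^sub>2(\<tau>)\<close>. Fix any \<open>\<sigma>\<close> above \<open>\<tau>\<close>. The freshness of the entries chosen at the stages above \<open>\<tau>\<close>
  is exactly what forces a tuple linked to some \<open>d\<close> with \<open>P\<^sub>d \<in> \<phi>\<^sub>2(\<tau>)\<close> never to extend \<open>a\<^sub>\<sigma>\<close>
  (\<open>linked_avoids\<close>). Therefore \<open>\<pi>(P)\<close>, for \<open>P\<close> the projection of \<open>a\<^sub>\<sigma>\<close>, annihilates every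
  \<open>\<pi>(V\<^sub>d\<^sub>e) v\<close>, hence \<open>\<pi>(\<A>) v\<close> by continuity of \<open>\<pi>\<close> (\<open>annihilates_orbit\<close>). As \<open>\<pi>(\<A>) v\<close> is
  dense, \<open>\<pi>(P) = 0\<close>, contrary to faithfulness.
\<close>

section \<open>Cauchy--Schwarz and adjoints\<close>

lemma Cauchy_Schwarz_cinner: "cmod (cinner x y) \<le> norm (x::'a::chilbert_space) * norm y"
proof (cases "y = 0")
  case False
  define N where "N = complex_of_real ((norm y)\<^sup>2)"
  \<comment> \<open>\<open>t y\<close> is the orthogonal projection of \<open>x\<close> to the line of \<open>y\<close>\<close>
  define t where "t = cinner x y / N"
  have N: "N \<noteq> 0" "cnj N = N" "cinner y y = N"
    using False by (simp_all add: N_def cinner_self)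
  have "cinner (x - t *\<^sub>C y) (x - t *\<^sub>C y)
      = cinner x x - cnj t * cinner x y - t * cnj (cinner x y) + t * cnj t * N"
    by (simp add: cinner_diff_left cinner_diff_right cinner_scaleC_left cinner_scaleC_right
        N(3) cinner_commute[of y x] algebra_simps)
  also have "\<dots> = cinner x x - cinner x y * cnj (cinner x y) / N"
    using N by (simp add: t_def)
  finally have "complex_of_real ((norm (x - t *\<^sub>C y))\<^sup>2)
      = complex_of_real ((norm x)\<^sup>2) - cinner x y * cnj (cinner x y) / complex_of_real ((norm y)\<^sup>2)"
    by (simp only: cinner_self N_def)
  also have "\<dots> = complex_of_real ((norm x)\<^sup>2 - (cmod (cinner x y))\<^sup>2 / (norm y)\<^sup>2)"
    by (simp add: complex_norm_square[symmetric])
  finally have "0 \<le> (norm x)\<^sup>2 - (cmod (cinner x y))\<^sup>2 / (norm y)\<^sup>2"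
    by (metis of_real_eq_iff zero_le_power2)
  then have "(cmod (cinner x y))\<^sup>2 \<le> (norm x * norm y)\<^sup>2"
    using False by (simp add: field_simps)
  then show ?thesis
    by (rule power2_le_imp_le) simp
qed simp

lemma bounded_linear_cinner_left: "bounded_linear (\<lambda>x. cinner x (y::'a::chilbert_space))"
proof (rule bounded_linear_intro[where K = "norm y"])
  show "cinner (t *\<^sub>R x) y = t *\<^sub>R cinner x y" for t x
    by (simp add: scaleR_conv_scaleC cinner_scaleC_left scaleR_conv_of_real)
qed (simp_all add: cinner_add_left Cauchy_Schwarz_cinner)

lemma bounded_linear_cinner_right: "bounded_linear (\<lambda>y. cinner (x::'a::chilbert_space) y)"
proof (rule bounded_linear_intro[where K = "norm x"])
  show "cinner x (t *\<^sub>R y) = t *\<^sub>R cinner x y" for t y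
    by (simp add: scaleR_conv_scaleC cinner_scaleC_right scaleR_conv_of_real)
  show "cmod (cinner x y) \<le> norm y * norm x" for y
    using Cauchy_Schwarz_cinner[of x y] by (simp add: mult.commute)
qed (simp add: cinner_add_right)

lemma is_adjoint_sym: "is_adjoint S T \<Longrightarrow> is_adjoint T S"
  unfolding is_adjoint_def by (metis cinner_commute)

text \<open>
  This makes the adjoint isometric, so that adjoints of a convergent sequence converge, and
  the existence of adjoints passes to closures.
\<close>

lemma norm_adjoint_le:
  assumes "is_adjoint S T"
  shows "norm S \<le> norm T"
proof (rule norm_blinfun_bound)
  fix y
  have "complex_of_real ((norm (S y))\<^sup>2) = cinner (T (S y)) y"
    using assms by (simp add: is_adjoint_def cinner_self)
  then have "(norm (S y))\<^sup>2 = cmod (cinner (T (S y)) y)"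
    by (metis norm_of_real abs_power2)
  also have "\<dots> \<le> norm (T (S y)) * norm y"
    by (rule Cauchy_Schwarz_cinner)
  also have "\<dots> \<le> norm T * norm (S y) * norm y"
    by (intro mult_right_mono norm_blinfun) simp
  finally have "norm (S y) * norm (S y) \<le> norm (S y) * (norm T * norm y)"
    by (simp add: power2_eq_square mult_ac)
  then show "norm (S y) \<le> norm T * norm y"
    by (cases "S y = 0") (auto simp: mult_le_cancel_left)
qed simp

lemma is_adjoint_zero: "is_adjoint 0 0"
  by (simp add: is_adjoint_def)

lemma is_adjoint_add: "is_adjoint S T \<Longrightarrow> is_adjoint S' T' \<Longrightarrow> is_adjoint (S + S') (T + T')"
  by (simp add: is_adjoint_def blinfun.add_left cinner_add_left cinner_add_right)

lemma is_adjoint_diff: "is_adjoint S T \<Longrightarrow> is_adjoint S' T' \<Longrightarrow> is_adjoint (S - S') (T - T')"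
  by (simp add: is_adjoint_def blinfun.diff_left cinner_diff_left cinner_diff_right)

lemma is_adjoint_scaleC: "is_adjoint S T \<Longrightarrow> is_adjoint (scaleC_op (cnj c) S) (scaleC_op c T)"
  by (simp add: is_adjoint_def cinner_scaleC_left cinner_scaleC_right)

lemma is_adjoint_comp: "is_adjoint S T \<Longrightarrow> is_adjoint S' T' \<Longrightarrow> is_adjoint (S' o\<^sub>L S) (T o\<^sub>L T')"
  by (simp add: is_adjoint_def)

lemma is_adjoint_limit:
  assumes "T \<longlonglongrightarrow> T'" "S \<longlonglongrightarrow> S'" "\<And>k::nat. is_adjoint (S k) (T k)"
  shows "is_adjoint S' T'"
  unfolding is_adjoint_def
proof (intro allI)
  fix x y
  have "(\<lambda>k. blinfun_apply (T k) x) \<longlonglongrightarrow> T' x" "(\<lambda>k. blinfun_apply (S k) y) \<longlonglongrightarrow> S' y"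
    using assms by (auto intro: tendsto_intros)
  then have "(\<lambda>k. cinner (T k x) y) \<longlonglongrightarrow> cinner (T' x) y"
    "(\<lambda>k. cinner x (S k y)) \<longlonglongrightarrow> cinner x (S' y)"
    using bounded_linear.tendsto[OF bounded_linear_cinner_left]
      bounded_linear.tendsto[OF bounded_linear_cinner_right] by blast+
  moreover have "(\<lambda>k. cinner (T k x) y) = (\<lambda>k. cinner x (S k y))"
    using assms(3) by (simp add: is_adjoint_def)
  ultimately show "cinner (T' x) y = cinner x (S' y)"
    by (metis LIMSEQ_unique)
qed

lemma scaleC_op_diff_right: "scaleC_op c (S - T) = scaleC_op c S - scaleC_op c T"
  by (intro blinfun_eqI)
    (simp add: blinfun.diff_left linear_diff[OF bounded_linear.linear[OF bounded_linear_scaleC]])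

lemma norm_scaleC_op_le: "norm (scaleC_op c T) \<le> cmod c * norm T"
proof (rule norm_blinfun_bound)
  show "norm (blinfun_apply (scaleC_op c T) x) \<le> cmod c * norm T * norm x" for x
    using norm_blinfun[of T x] by (simp add: norm_scaleC mult.assoc mult_left_mono)
qed simp

lemma tendsto_scaleC_op:
  fixes T :: "'i \<Rightarrow> 'h::chilbert_space \<Rightarrow>\<^sub>L 'h"
  assumes "(T \<longlongrightarrow> T') F"
  shows "((\<lambda>k. scaleC_op c (T k)) \<longlongrightarrow> scaleC_op c T') F"
proof (rule bounded_linear.tendsto[OF _ assms], rule bounded_linear_intro[where K = "cmod c"])
  show "scaleC_op c (S + T) = scaleC_op c S + scaleC_op c T" for S T :: "'h \<Rightarrow>\<^sub>L 'h"
    by (intro blinfun_eqI) (simp add: blinfun.add_left scaleC_add_right)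
  show "scaleC_op c (t *\<^sub>R T) = t *\<^sub>R scaleC_op c T" for t and T :: "'h \<Rightarrow>\<^sub>L 'h"
    by (intro blinfun_eqI) (simp add: blinfun.scaleR_left scaleR_conv_scaleC scaleC_scaleC mult.commute)
  show "norm (scaleC_op c T) \<le> norm T * cmod c" for T :: "'h \<Rightarrow>\<^sub>L 'h"
    using norm_scaleC_op_le[of c T] by (simp add: mult.commute)
qed

lemma adjoint_in_closure:
  assumes adj: "\<And>T. T \<in> M \<Longrightarrow> \<exists>S\<in>M. is_adjoint S T" and sub: "op_subspace M"
    and T: "T \<in> closure M"
  shows "\<exists>S\<in>closure M. is_adjoint S T"
proof -
  obtain t where t: "\<And>k. t k \<in> M" "t \<longlonglongrightarrow> T"
    using T unfolding closure_sequential by blast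
  obtain s where s: "\<And>k. s k \<in> M" "\<And>k. is_adjoint (s k) (t k)"
    using adj[OF t(1)] by metis
  have "Cauchy s"
    unfolding Cauchy_iff
  proof (intro allI impI)
    fix e :: real assume "0 < e"
    then obtain N where N: "\<forall>m\<ge>N. \<forall>k\<ge>N. norm (t m - t k) < e"
      using LIMSEQ_imp_Cauchy[OF t(2)] unfolding Cauchy_iff by blast
    have "norm (s m - s k) \<le> norm (t m - t k)" for m k
      by (rule norm_adjoint_le, rule is_adjoint_diff) (rule s)+
    then show "\<exists>N. \<forall>m\<ge>N. \<forall>k\<ge>N. norm (s m - s k) < e"
      using N by (meson le_less_trans)
  qed
  then obtain S where S: "s \<longlonglongrightarrow> S"
    using Cauchy_convergent convergent_def by blast
  have "S \<in> closure M"
    using S s(1) unfolding closure_sequential by blast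
  moreover have "is_adjoint S T"
    using t(2) S s(2) by (rule is_adjoint_limit)
  ultimately show ?thesis ..
qed

lemma cstar_subalgebra_closure:
  assumes M: "M \<subseteq> bounded_ops" "op_subspace M"
    and comp: "\<And>S T. S \<in> M \<Longrightarrow> T \<in> M \<Longrightarrow> S o\<^sub>L T \<in> M"
    and adj: "\<And>T. T \<in> M \<Longrightarrow> \<exists>S\<in>M. is_adjoint S T"
  shows "cstar_subalgebra (closure M)"
  unfolding cstar_subalgebra_def op_subspace_def
proof (intro conjI ballI allI impI)
  show "closure M \<subseteq> bounded_ops"
    using M(1) closed_bounded_ops by (rule closure_minimal)
  show "0 \<in> closure M"
    using M(2) closure_subset unfolding op_subspace_def by blast
next
  fix S T
  assume "S \<in> closure M" "T \<in> closure M"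
  then obtain s t where st: "\<And>k. s k \<in> M" "s \<longlonglongrightarrow> S" "\<And>k. t k \<in> M" "t \<longlonglongrightarrow> T"
    unfolding closure_sequential by blast
  have lim: "(\<lambda>k. s k + t k) \<longlonglongrightarrow> S + T" "(\<lambda>k. s k o\<^sub>L t k) \<longlonglongrightarrow> (S o\<^sub>L T)"
    using st(2,4) by (auto intro!: tendsto_intros
        bounded_bilinear.tendsto[OF bounded_bilinear_blinfun_compose])
  have mem: "s k + t k \<in> closure M" "s k o\<^sub>L t k \<in> closure M" for k
    using st comp M(2) closure_subset[of M] unfolding op_subspace_def by auto
  show "S + T \<in> closure M" "(S o\<^sub>L T) \<in> closure M"
    by (rule closed_sequentially[OF closed_closure _ lim(1)], rule mem(1))
      (rule closed_sequentially[OF closed_closure _ lim(2)], rule mem(2))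
next
  fix c T
  assume "T \<in> closure M"
  then obtain t where t: "\<And>k. t k \<in> M" "t \<longlonglongrightarrow> T"
    unfolding closure_sequential by blast
  have "scaleC_op c (t k) \<in> closure M" for k
    using t(1) M(2) closure_subset[of M] unfolding op_subspace_def by auto
  then show "scaleC_op c T \<in> closure M"
    using tendsto_scaleC_op[OF t(2)] by (rule closed_sequentially[OF closed_closure])
next
  fix S T
  assume "T \<in> closure M" "is_adjoint S T"
  then show "S \<in> closure M"
    using adjoint_in_closure[OF adj M(2)] is_adjoint_unique by metis
qed simp

section \<open>Automatic continuity of representations\<close>

text \<open>
  A quasi square root: formally \<open>(1 - Q)\<^sup>2 = 1 - S\<close>, written without the unit, which \<open>A\<close> need not
  contain. The equation says that \<open>Q\<close> is a fixed point of \<open>Q \<mapsto> (S + Q\<^sup>2) / 2\<close>, which is a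
  contraction of the self-adjoint elements of norm at most \<open>1 / 2\<close>.
\<close>

lemma cstar_subalgebra_square_root:
  assumes A: "cstar_subalgebra A" and S: "S \<in> A" "is_adjoint S S" "norm S \<le> 1 / 4"
  shows "\<exists>Q\<in>A. is_adjoint Q Q \<and> Q + Q = S + (Q o\<^sub>L Q)"
proof -
  define D where "D = {Q \<in> A. is_adjoint Q Q \<and> norm Q \<le> 1 / 2}"
  define f where "f Q = scaleC_op (1 / 2) (S + (Q o\<^sub>L Q))" for Q
  have "closed D"
    unfolding closed_sequential_limits
  proof (intro allI impI, elim conjE)
    fix q Q assume q: "\<forall>k. q k \<in> D" "q \<longlonglongrightarrow> Q"
    have "Q \<in> A"
      using A q closed_sequentially[of A q Q] by (auto simp: D_def cstar_subalgebra_def)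
    moreover have "is_adjoint Q Q"
      using q by (intro is_adjoint_limit[of q Q q Q]) (auto simp: D_def)
    moreover have "norm Q \<le> 1 / 2"
      by (rule Lim_norm_ubound[OF _ q(2)]) (use q in \<open>auto simp: D_def\<close>)
    ultimately show "Q \<in> D"
      by (simp add: D_def)
  qed
  have "\<exists>!Q\<in>D. f Q = Q"
  proof (rule Banach_fix[where c = "1/2"])
    show "complete D"
      using \<open>closed D\<close> by (simp add: complete_eq_closed)
    show "D \<noteq> {}"
      using A is_adjoint_zero by (auto simp: D_def cstar_subalgebra_def op_subspace_def intro!: exI[of _ 0])
    show "f ` D \<subseteq> D"
    proof (rule image_subsetI)
      fix Q assume Q: "Q \<in> D"
      have "f Q \<in> A"
        using A S Q by (simp add: f_def D_def cstar_subalgebra_def op_subspace_def)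
      moreover have "is_adjoint (f Q) (f Q)"
        using is_adjoint_scaleC[of "S + (Q o\<^sub>L Q)" "S + (Q o\<^sub>L Q)" "1/2"] S Q
        by (auto simp: f_def D_def intro!: is_adjoint_add is_adjoint_comp)
      moreover have "norm (f Q) \<le> 1 / 2"
      proof -
        have "norm (f Q) \<le> 1/2 * norm (S + (Q o\<^sub>L Q))"
          unfolding f_def using norm_scaleC_op_le[of "1/2" "S + (Q o\<^sub>L Q)"] by simp
        also have "norm (S + (Q o\<^sub>L Q)) \<le> norm S + norm Q * norm Q"
          by (intro norm_triangle_le add_mono norm_blinfun_compose order_refl)
        also have "norm Q * norm Q \<le> 1/2 * (1/2)"
          using Q by (intro mult_mono) (auto simp: D_def)
        finally show ?thesis using S(3) by simp
      qed
      ultimately show "f Q \<in> D" by (simp add: D_def)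
    qed
    show "dist (f Q) (f R) \<le> 1 / 2 * dist Q R" if QR: "Q \<in> D" "R \<in> D" for Q R
    proof -
      have "f Q - f R = scaleC_op (1/2) ((Q o\<^sub>L (Q - R)) + ((Q - R) o\<^sub>L R))"
        unfolding f_def scaleC_op_diff_right[symmetric]
        by (intro arg_cong[where f = "scaleC_op _"] blinfun_eqI)
          (simp add: blinfun.add_left blinfun.diff_left blinfun.diff_right)
      then have "norm (f Q - f R) \<le> 1/2 * norm ((Q o\<^sub>L (Q - R)) + ((Q - R) o\<^sub>L R))"
        using norm_scaleC_op_le[of "1/2" "(Q o\<^sub>L (Q - R)) + ((Q - R) o\<^sub>L R)"] by simp
      also have "norm ((Q o\<^sub>L (Q - R)) + ((Q - R) o\<^sub>L R)) \<le> norm Q * norm (Q - R) + norm (Q - R) * norm R"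
        by (intro norm_triangle_le add_mono norm_blinfun_compose)
      also have "\<dots> \<le> 1/2 * norm (Q - R) + norm (Q - R) * (1/2)"
        using QR by (intro add_mono mult_mono) (auto simp: D_def)
      finally show "dist (f Q) (f R) \<le> 1 / 2 * dist Q R"
        by (simp add: dist_norm)
    qed
  qed simp_all
  then obtain Q where Q: "Q \<in> D" "f Q = Q" by blast
  have "Q + Q = f Q + f Q"
    using Q by simp
  also have "\<dots> = S + (Q o\<^sub>L Q)"
  proof (rule blinfun_eqI)
    fix x
    have "blinfun_apply (f Q + f Q) x = (1/2 + 1/2) *\<^sub>C blinfun_apply (S + (Q o\<^sub>L Q)) x"
      unfolding scaleC_add_left by (simp add: f_def blinfun.add_left)
    then show "blinfun_apply (f Q + f Q) x = blinfun_apply (S + (Q o\<^sub>L Q)) x"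
      by simp
  qed
  finally show ?thesis
    using Q by (auto simp: D_def)
qed

text \<open>
  With \<open>S = T\<^sup>* T\<close> and \<open>(1 - Q)\<^sup>2 = 1 - S\<close>, applying \<open>\<pi>\<close> gives
  \<open>\<parallel>v\<parallel>\<^sup>2 - \<parallel>\<pi>(T) v\<parallel>\<^sup>2 = \<parallel>v - \<pi>(Q) v\<parallel>\<^sup>2\<close>, which is nonnegative.
\<close>

lemma star_representation_contractive:
  assumes A: "cstar_subalgebra A" and rep: "star_representation A \<pi>"
    and T: "T \<in> A" "norm T \<le> 1 / 2" and T': "is_adjoint T' T"
  shows "norm (\<pi> T v) \<le> norm v"
proof -
  define S where "S = T' o\<^sub>L T"
  have T'A: "T' \<in> A"
    using A T T' by (auto simp: cstar_subalgebra_def)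
  have SA: "S \<in> A"
    using A T T'A by (auto simp: S_def cstar_subalgebra_def)
  have "norm S \<le> norm T' * norm T"
    unfolding S_def by (rule norm_blinfun_compose)
  also have "\<dots> \<le> 1/2 * (1/2)"
    using T norm_adjoint_le[OF T'] by (intro mult_mono) auto
  finally have "norm S \<le> 1/4" by simp
  moreover have "is_adjoint S S"
    unfolding S_def using T' is_adjoint_sym[OF T'] by (intro is_adjoint_comp)
  ultimately obtain Q where Q: "Q \<in> A" "is_adjoint Q Q" "Q + Q = S + (Q o\<^sub>L Q)"
    using cstar_subalgebra_square_root[OF A SA] by blast
  have QQ: "Q o\<^sub>L Q \<in> A"
    using A Q by (auto simp: cstar_subalgebra_def)
  have "\<pi> Q + \<pi> Q = \<pi> S + (\<pi> Q o\<^sub>L \<pi> Q)"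
    using rep Q SA QQ unfolding star_representation_def by metis
  then have "\<pi> S v + \<pi> Q (\<pi> Q v) = \<pi> Q v + \<pi> Q v"
    by (metis blinfun.add_left blinfun_apply_blinfun_compose)
  then have \<pi>S: "\<pi> S v = \<pi> Q v + \<pi> Q v - \<pi> Q (\<pi> Q v)"
    by (simp add: eq_diff_eq)
  have \<pi>Q: "cinner (\<pi> Q x) y = cinner x (\<pi> Q y)" for x y
    using rep Q unfolding star_representation_def is_adjoint_def by blast
  have \<pi>T: "cinner (\<pi> T x) y = cinner x (\<pi> T' y)" for x y
    using rep T T'A T' unfolding star_representation_def is_adjoint_def by blast
  have "\<pi> S = \<pi> T' o\<^sub>L \<pi> T"
    using rep T T'A unfolding star_representation_def S_def by blast
  then have "cinner v (\<pi> S v) = cinner (\<pi> T v) (\<pi> T v)"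
    by (simp add: \<pi>T)
  moreover have "cinner v (\<pi> S v) = cinner v v - cinner (v - \<pi> Q v) (v - \<pi> Q v)"
    unfolding \<pi>S by (simp add: cinner_add_right cinner_diff_right cinner_diff_left \<pi>Q)
  ultimately have "complex_of_real ((norm (\<pi> T v))\<^sup>2) = complex_of_real ((norm v)\<^sup>2 - (norm (v - \<pi> Q v))\<^sup>2)"
    by (simp only: cinner_self of_real_diff)
  then have "(norm (\<pi> T v))\<^sup>2 = (norm v)\<^sup>2 - (norm (v - \<pi> Q v))\<^sup>2"
    by (simp only: of_real_eq_iff)
  then have "(norm (\<pi> T v))\<^sup>2 \<le> (norm v)\<^sup>2"
    by simp
  then show ?thesis
    by (rule power2_le_imp_le) simp
qed

lemma star_representation_bounded:
  assumes A: "cstar_subalgebra A" and rep: "star_representation A \<pi>"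
    and T: "T \<in> A" and T': "is_adjoint T' T"
  shows "norm (\<pi> T v) \<le> 2 * norm T * norm v"
proof (cases "T = 0")
  case True
  have "\<pi> (0 + 0) = \<pi> 0 + \<pi> 0"
    using rep T True unfolding star_representation_def by blast
  then show ?thesis using True by simp
next
  case False
  \<comment> \<open>scale to norm \<open>1 / 2\<close>, where the contraction estimate applies\<close>
  define c where "c = complex_of_real (1 / (2 * norm T))"
  have cT: "scaleC_op c T \<in> A"
    using A T by (auto simp: cstar_subalgebra_def op_subspace_def)
  have c: "cmod c = 1 / (2 * norm T)"
    unfolding c_def norm_of_real by simp
  have "norm (scaleC_op c T) \<le> 1/2"
    using norm_scaleC_op_le[of c T] False by (simp add: c)
  then have "norm (\<pi> (scaleC_op c T) v) \<le> norm v"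
    using star_representation_contractive[OF A rep cT _ is_adjoint_scaleC[OF T']] by blast
  moreover have "\<pi> (scaleC_op c T) = scaleC_op c (\<pi> T)"
    using rep T unfolding star_representation_def by blast
  ultimately show ?thesis
    using False by (simp add: norm_scaleC c field_simps)
qed

lemma cstar_subalgebra_diff:
  assumes "cstar_subalgebra A" "S \<in> A" "T \<in> A"
  shows "S - T \<in> A"
proof -
  have "S + scaleC_op (-1) T \<in> A"
    using assms by (simp add: cstar_subalgebra_def op_subspace_def)
  also have "S + scaleC_op (-1) T = S - T"
    by (intro blinfun_eqI) (simp add: blinfun.add_left blinfun.diff_left scaleC_minus1)
  finally show ?thesis .
qed

lemma star_representation_zero: "star_representation A \<pi> \<Longrightarrow> 0 \<in> A \<Longrightarrow> \<pi> 0 = 0"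
  unfolding star_representation_def by (metis add.right_neutral add_left_cancel)

lemma star_representation_diff:
  assumes "cstar_subalgebra A" "star_representation A \<pi>" "S \<in> A" "T \<in> A"
  shows "\<pi> (S - T) = \<pi> S - \<pi> T"
proof -
  have "S - T \<in> A"
    using assms by (intro cstar_subalgebra_diff)
  then have "\<pi> ((S - T) + T) = \<pi> (S - T) + \<pi> T"
    using assms unfolding star_representation_def by blast
  then show ?thesis by simp
qed

lemma star_representation_tendsto:
  assumes A: "cstar_subalgebra A" and rep: "star_representation A \<pi>"
    and adj: "\<And>T. T \<in> A \<Longrightarrow> \<exists>S. is_adjoint S T"
    and s: "\<And>k. s k \<in> A" "T \<in> A" "s \<longlonglongrightarrow> T"
  shows "(\<lambda>k::nat. \<pi> (s k) v) \<longlonglongrightarrow> \<pi> T v"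
proof -
  have bound: "norm (\<pi> (s k) v - \<pi> T v) \<le> 2 * norm (s k - T) * norm v" for k
  proof -
    have diff: "s k - T \<in> A"
      using A s(1,2) by (rule cstar_subalgebra_diff)
    obtain S where "is_adjoint S (s k - T)"
      using adj[OF diff] ..
    then have "norm (\<pi> (s k - T) v) \<le> 2 * norm (s k - T) * norm v"
      by (rule star_representation_bounded[OF A rep diff])
    then show ?thesis
      unfolding star_representation_diff[OF A rep s(1,2)] blinfun.diff_left .
  qed
  have "(\<lambda>k. norm (s k - T)) \<longlonglongrightarrow> 0"
    using s(3) by (intro tendsto_norm_zero) (rule LIM_zero)
  from tendsto_mult_right[OF tendsto_mult_left[OF this, of 2], of "norm v"]
  have "(\<lambda>k. 2 * norm (s k - T) * norm v) \<longlonglongrightarrow> 0"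
    by simp
  then have "(\<lambda>k. \<pi> (s k) v - \<pi> T v) \<longlonglongrightarrow> 0"
    by (rule Lim_null_comparison[OF always_eventually, rotated]) (use bound in blast)
  then show ?thesis
    by (rule LIM_zero_cancel)
qed

section \<open>Complex linear spans of operators\<close>

text \<open>
  Complex linear combinations, built one summand at a time so that a property of the span can be
  proved by induction on the number of summands.
\<close>

inductive_set op_span :: "('h::chilbert_space \<Rightarrow>\<^sub>L 'h) set \<Rightarrow> ('h \<Rightarrow>\<^sub>L 'h) set" for G where
  zero: "0 \<in> op_span G"
| add: "g \<in> G \<Longrightarrow> T \<in> op_span G \<Longrightarrow> scaleC_op c g + T \<in> op_span G"

lemma op_span_plus: "S \<in> op_span G \<Longrightarrow> T \<in> op_span G \<Longrightarrow> S + T \<in> op_span G"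
  by (induction S rule: op_span.induct) (auto simp: add.assoc intro: op_span.add)

lemma scaleC_op_simps:
  "scaleC_op c (S + T) = scaleC_op c S + scaleC_op c T"
  "scaleC_op c 0 = 0"
  "scaleC_op 0 T = 0"
  "scaleC_op 1 T = T"
  "scaleC_op c (scaleC_op d T) = scaleC_op (c * d) T"
  by (intro blinfun_eqI; simp add: blinfun.add_left scaleC_add_right scaleC_scaleC)+

lemma scaleC_op_comp: "scaleC_op c S o\<^sub>L T = scaleC_op c (S o\<^sub>L T)"
  by (intro blinfun_eqI) simp

lemma comp_scaleC_op: "S \<in> bounded_ops \<Longrightarrow> S o\<^sub>L scaleC_op c T = scaleC_op c (S o\<^sub>L T)"
  by (intro blinfun_eqI) (simp add: bounded_ops_def)

lemma comp_simps:
  "(S + S') o\<^sub>L T = (S o\<^sub>L T) + (S' o\<^sub>L T)"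
  "S o\<^sub>L (T + T') = (S o\<^sub>L T) + (S o\<^sub>L T')"
  "0 o\<^sub>L T = 0" "S o\<^sub>L 0 = 0"
  "(S o\<^sub>L T) o\<^sub>L U = S o\<^sub>L (T o\<^sub>L U)"
  by (intro blinfun_eqI; simp add: blinfun.add_left blinfun.add_right)+

lemma op_span_scaleC: "T \<in> op_span G \<Longrightarrow> scaleC_op c T \<in> op_span G"
  by (induction T rule: op_span.induct) (auto simp: scaleC_op_simps intro: op_span.intros)

lemma op_subspace_op_span: "op_subspace (op_span G)"
  by (auto simp: op_subspace_def intro: op_span.zero op_span_plus op_span_scaleC)

lemma op_span_base: "g \<in> G \<Longrightarrow> g \<in> op_span G"
  using op_span.add[OF _ op_span.zero, of g G 1] by (simp add: scaleC_op_simps)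

lemma op_span_minimal:
  assumes "op_subspace M" "G \<subseteq> M"
  shows "op_span G \<subseteq> M"
proof
  fix T assume "T \<in> op_span G"
  then show "T \<in> M"
    using assms by induction (auto simp: op_subspace_def)
qed

lemma cstar_subalgebra_closure_op_span:
  assumes G: "G \<subseteq> bounded_ops"
    and comp: "\<And>S T. S \<in> G \<Longrightarrow> T \<in> G \<Longrightarrow> S o\<^sub>L T \<in> insert 0 G"
    and adj: "\<And>T. T \<in> G \<Longrightarrow> \<exists>S\<in>G. is_adjoint S T"
  shows "cstar_subalgebra (closure (op_span G))"
    and "T \<in> closure (op_span G) \<Longrightarrow> \<exists>S. is_adjoint S T"
proof -
  have comp1: "S o\<^sub>L T \<in> op_span G" if "S \<in> G" "T \<in> op_span G" for S T
    using that(2)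
  proof induction
    case zero
    show ?case by (simp add: comp_simps op_span.zero)
  next
    case (add g T c)
    have "S o\<^sub>L g \<in> op_span G"
      using comp[OF that(1) add.hyps(1)] by (auto intro: op_span_base op_span.zero)
    moreover have "S \<in> bounded_ops"
      using that(1) G by blast
    ultimately show ?case
      using add.IH by (simp add: comp_simps comp_scaleC_op op_span_plus op_span_scaleC)
  qed
  have comp2: "S o\<^sub>L T \<in> op_span G" if "S \<in> op_span G" "T \<in> op_span G" for S T
    using that(1) by induction
      (auto simp: comp_simps scaleC_op_comp intro!: op_span.zero op_span_plus op_span_scaleC comp1 that(2))
  have adj': "\<exists>S\<in>op_span G. is_adjoint S T" if "T \<in> op_span G" for T
    using that
  proof induction
    case zero
    show ?case using is_adjoint_zero op_span.zero by (rule bexI)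
  next
    case (add g T c)
    obtain s where "s \<in> G" "is_adjoint s g"
      using adj[OF add.hyps(1)] by blast
    moreover obtain S where "S \<in> op_span G" "is_adjoint S T"
      using add.IH by blast
    ultimately have "is_adjoint (scaleC_op (cnj c) s + S) (scaleC_op c g + T)"
      "scaleC_op (cnj c) s + S \<in> op_span G"
      by (auto intro: is_adjoint_add is_adjoint_scaleC op_span.add)
    then show ?case ..
  qed
  have "op_span G \<subseteq> bounded_ops"
    using G cstar_subalgebra_bounded_ops by (intro op_span_minimal) (auto simp: cstar_subalgebra_def)
  then show "cstar_subalgebra (closure (op_span G))"
    using op_subspace_op_span comp2 adj' by (rule cstar_subalgebra_closure)
  show "\<exists>S. is_adjoint S T" if "T \<in> closure (op_span G)"
    using adjoint_in_closure[OF adj' op_subspace_op_span that] by blast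
qed

section \<open>The partial isometries\<close>

lemma overwrite_in_cyl [simp]: "overwrite d x \<in> cyl d"
  by (simp add: overwrite_def cyl_def)

lemma overwrite_id: "x \<in> cyl d \<Longrightarrow> overwrite d x = x"
  by (auto simp: overwrite_def cyl_def)

lemma cyl_append: "x \<in> cyl (d @ y) \<Longrightarrow> x \<in> cyl d"
  by (auto simp: cyl_def nth_append)

lemma cyl_isometry_self: "cyl_isometry d d = cyl_proj d"
  by (intro blinfun_eqI ell2_eqI) (simp add: cyl_isometry_apply cyl_proj_apply overwrite_id)

lemma cyl_isometry_adjoint:
  assumes len: "length d = length e"
  shows "is_adjoint (cyl_isometry e d) (cyl_isometry d e)"
  unfolding is_adjoint_def
proof (intro allI)
  fix \<xi> \<eta>
  have "cinner (cyl_isometry d e \<xi>) \<eta>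
      = (\<Sum>\<^sub>\<infinity>x\<in>cyl e. ell2_fun \<xi> (overwrite d x) * cnj (ell2_fun \<eta> x))"
    unfolding cinner_ell2_def by (rule infsum_cong_neutral) (auto simp: cyl_isometry_apply len)
  also have "\<dots> = (\<Sum>\<^sub>\<infinity>x\<in>cyl e. ell2_fun \<xi> (overwrite d x) *
      cnj (ell2_fun \<eta> (overwrite e (overwrite d x))))"
  proof (rule infsum_cong)
    fix x assume "x \<in> cyl e"
    then have "overwrite e (overwrite d x) = x"
      using len by (auto simp: overwrite_def cyl_def fun_eq_iff)
    then show "ell2_fun \<xi> (overwrite d x) * cnj (ell2_fun \<eta> x) = ell2_fun \<xi> (overwrite d x) *
        cnj (ell2_fun \<eta> (overwrite e (overwrite d x)))"
      by simp
  qed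
  also have "\<dots> = (\<Sum>\<^sub>\<infinity>y\<in>cyl d. ell2_fun \<xi> y * cnj (ell2_fun \<eta> (overwrite e y)))"
    using infsum_reindex_bij_betw[OF bij_betw_overwrite[OF len],
        of "\<lambda>y. ell2_fun \<xi> y * cnj (ell2_fun \<eta> (overwrite e y))"] .
  also have "\<dots> = cinner \<xi> (cyl_isometry e d \<eta>)"
    unfolding cinner_ell2_def by (rule infsum_cong_neutral) (auto simp: cyl_isometry_apply len)
  finally show "cinner (cyl_isometry d e \<xi>) \<eta> = cinner \<xi> (cyl_isometry e d \<eta>)" .
qed

text \<open>
  Restricted to \<open>l\<^sup>2\<close> of a smaller cylinder, \<open>V\<^sub>d\<^sub>e\<close> exchanges the initial segment and keeps the
  further entries \<open>y\<close>. This and the next lemma are the two nonzero cases of a product.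
\<close>

lemma cyl_isometry_comp_longer:
  assumes "length d = length e" "length f = length (e @ y)"
  shows "cyl_isometry (e @ y) f o\<^sub>L cyl_isometry d e = cyl_isometry (d @ y) f"
proof (intro blinfun_eqI ell2_eqI)
  fix \<xi> x
  have "overwrite (e @ y) x \<in> cyl e"
    by (rule cyl_append[OF overwrite_in_cyl])
  moreover have "overwrite d (overwrite (e @ y) x) = overwrite (d @ y) x"
    using assms by (auto simp: overwrite_def fun_eq_iff nth_append)
  ultimately show "ell2_fun ((cyl_isometry (e @ y) f o\<^sub>L cyl_isometry d e) \<xi>) x
      = ell2_fun (cyl_isometry (d @ y) f \<xi>) x"
    using assms by (simp add: cyl_isometry_apply)
qed

lemma cyl_isometry_comp_shorter:
  assumes "length d = length (e @ y)" "length f = length e"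
  shows "cyl_isometry e f o\<^sub>L cyl_isometry d (e @ y) = cyl_isometry d (f @ y)"
proof (intro blinfun_eqI ell2_eqI)
  fix \<xi> x
  have "x \<in> cyl f \<and> overwrite e x \<in> cyl (e @ y) \<longleftrightarrow> x \<in> cyl (f @ y)"
  proof -
    have "(\<forall>i<length (f @ y). x i = (f @ y) ! i) \<longleftrightarrow>
        (\<forall>i<length f. x i = f ! i) \<and> (\<forall>i<length (f @ y). \<not> i < length f \<longrightarrow> x i = y ! (i - length f))"
      by (force simp: nth_append)
    then show ?thesis
      using assms by (force simp: cyl_def overwrite_def nth_append)
  qed
  moreover have "overwrite d (overwrite e x) = overwrite d x"
    using assms by (auto simp: overwrite_def fun_eq_iff)
  ultimately show "ell2_fun ((cyl_isometry e f o\<^sub>L cyl_isometry d (e @ y)) \<xi>) x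
      = ell2_fun (cyl_isometry d (f @ y) \<xi>) x"
    using assms by (auto simp: cyl_isometry_apply)
qed

lemma common_cyl_prefix:
  assumes "x \<in> cyl d" "x \<in> cyl e" "length d \<le> length e"
  shows "\<exists>y. e = d @ y"
proof -
  have "take (length d) e = d"
    using assms by (intro nth_equalityI) (auto simp: cyl_def)
  then have "e = d @ drop (length d) e"
    using append_take_drop_id[of "length d" e] by simp
  then show ?thesis ..
qed

text \<open>
  Two cylinders are disjoint or nested.
\<close>

lemma cyl_isometry_comp_cases:
  assumes "length d = length e" "length e' = length f"
  obtains "cyl_isometry e' f o\<^sub>L cyl_isometry d e = 0"
  | y where "e' = e @ y" "cyl_isometry e' f o\<^sub>L cyl_isometry d e = cyl_isometry (d @ y) f"
  | y where "e = e' @ y" "cyl_isometry e' f o\<^sub>L cyl_isometry d e = cyl_isometry d (f @ y)"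
proof (cases "cyl e \<inter> cyl e' = {}")
  case True
  then have "overwrite e' x \<notin> cyl e" for x
    using overwrite_in_cyl[of e' x] by auto
  then have "cyl_isometry e' f o\<^sub>L cyl_isometry d e = 0"
    using assms by (intro blinfun_eqI ell2_eqI) (simp add: cyl_isometry_apply zero_ell2.rep_eq)
  then show thesis by (rule that(1))
next
  case False
  then obtain x where x: "x \<in> cyl e" "x \<in> cyl e'" by auto
  show thesis
  proof (cases "length e \<le> length e'")
    case True
    obtain y where y: "e' = e @ y"
      using common_cyl_prefix[OF x True] by (rule exE)
    show thesis
    proof (rule that(2)[OF y])
      show "cyl_isometry e' f o\<^sub>L cyl_isometry d e = cyl_isometry (d @ y) f"
        unfolding y by (rule cyl_isometry_comp_longer) (use assms y in simp_all)
    qed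
  next
    case False
    then have "length e' \<le> length e" by simp
    then obtain y where y: "e = e' @ y"
      using common_cyl_prefix[OF x(2,1)] by auto
    show thesis
    proof (rule that(3)[OF y])
      show "cyl_isometry e' f o\<^sub>L cyl_isometry d e = cyl_isometry d (f @ y)"
        unfolding y by (rule cyl_isometry_comp_shorter) (use assms y in simp_all)
    qed
  qed
qed

lemma cyl_iff_prefix:
  assumes "x \<in> cyl c" "length e \<le> length c"
  shows "x \<in> cyl e \<longleftrightarrow> take (length e) c = e"
proof
  assume "x \<in> cyl e"
  then show "take (length e) c = e"
    using common_cyl_prefix[of x e c] assms by auto
next
  assume "take (length e) c = e"
  then have "e @ drop (length e) c = c"
    using append_take_drop_id[of "length e" c] by (simp only:)
  then show "x \<in> cyl e"
    using assms(1) cyl_append[of x e "drop (length e) c"] by (simp only:)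
qed

text \<open>
  A matrix coefficient of \<open>P\<^sub>c V\<^sub>d\<^sub>e P\<^sub>c\<close> can be nonzero only if \<open>c\<close> extends both \<open>d\<close> and \<open>e\<close>; these have
  the same length, so \<open>d = e\<close> and the compression is \<open>P\<^sub>c\<close> itself.
\<close>

lemma cyl_proj_compress:
  assumes len: "length d = length e" "length e \<le> length c"
  shows "\<exists>\<mu>. cyl_proj c o\<^sub>L (cyl_isometry d e o\<^sub>L cyl_proj c) = scaleC_op \<mu> (cyl_proj c)"
proof (intro exI blinfun_eqI ell2_eqI)
  fix \<xi> x
  let ?\<mu> = "if take (length d) c = d \<and> take (length e) c = e then 1 else 0"
  have "ell2_fun (cyl_proj c (cyl_isometry d e (cyl_proj c \<xi>))) x = ?\<mu> * ell2_fun (cyl_proj c \<xi>) x"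
  proof (cases "x \<in> cyl c")
    case x: True
    have e: "x \<in> cyl e \<longleftrightarrow> take (length e) c = e"
      by (rule cyl_iff_prefix[OF x len(2)])
    show ?thesis
    proof (cases "take (length d) c = d")
      case True
      then have "x \<in> cyl d"
        using cyl_iff_prefix[OF x, of d] len by simp
      then have "overwrite d x = x"
        by (rule overwrite_id)
      then show ?thesis
        using True x e len(1) by (auto simp: cyl_isometry_apply cyl_proj_apply)
    next
      case False
      then have "overwrite d x \<notin> cyl c"
        using cyl_iff_prefix[of "overwrite d x" c d] len overwrite_in_cyl[of d x] by auto
      then show ?thesis
        using False len(1) by (simp add: cyl_isometry_apply cyl_proj_apply)
    qed
  qed (simp add: cyl_proj_apply)
  then show "ell2_fun ((cyl_proj c o\<^sub>L (cyl_isometry d e o\<^sub>L cyl_proj c)) \<xi>) x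
     = ell2_fun (scaleC_op ?\<mu> (cyl_proj c) \<xi>) x"
    by (simp add: scaleC_ell2.rep_eq)
qed

lemma cyl_proj_idem: "cyl_proj c o\<^sub>L cyl_proj c = cyl_proj c"
  by (intro blinfun_eqI ell2_eqI) (simp add: cyl_proj_apply)

lemma cyl_proj_adjoint: "is_adjoint (cyl_proj c) (cyl_proj c)"
  using cyl_isometry_adjoint[of c c] by (simp add: cyl_isometry_self)

lemma cyl_proj_orthogonal:
  assumes "length c = length d" "c \<noteq> d"
  shows "cyl_proj c o\<^sub>L cyl_proj d = 0"
proof (intro blinfun_eqI ell2_eqI)
  fix \<xi> x
  have "\<not> (x \<in> cyl c \<and> x \<in> cyl d)"
    using cyl_iff_prefix[of x c d] assms by auto
  then show "ell2_fun ((cyl_proj c o\<^sub>L cyl_proj d) \<xi>) x = ell2_fun (blinfun_apply 0 \<xi>) x"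
    by (simp add: cyl_proj_apply zero_ell2.rep_eq)
qed

lemma cyl_proj_nonzero: "cyl_proj c \<noteq> 0"
proof
  let ?x = "overwrite c (\<lambda>_. 0)"
  assume "cyl_proj c = 0"
  then have "ell2_fun (cyl_proj c (ell2_indicator ?x)) ?x = ell2_fun 0 ?x"
    by simp
  then show False
    by (simp add: cyl_proj_apply zero_ell2.rep_eq)
qed

lemma cyl_proj_append_comp: "cyl_proj (c @ y) o\<^sub>L cyl_proj c = cyl_proj (c @ y)"
  using cyl_isometry_comp_longer[of c c "c @ y" y] by (simp add: cyl_isometry_self)

lemma cyl_isometry_comp_middle:
  assumes "length d = length e" "length f = length e"
  shows "cyl_isometry e f o\<^sub>L cyl_isometry d e = cyl_isometry d f"
  using cyl_isometry_comp_longer[of d e f "[]"] assms by simp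

section \<open>Nonzero ideals contain a cylinder projection\<close>

text \<open>
  In the quotient by \<open>I\<close> the idempotent \<open>P\<close> equals the class of \<open>E = P - S\<close>, hence the class of
  every power of \<open>E\<close>, and these powers tend to 0. The sequence \<open>X\<^sub>k = P E\<^sup>k\<close> carries this out without
  forming the quotient.
\<close>

lemma idempotent_in_closed_ideal:
  assumes A: "cstar_subalgebra A" and I: "closed_ideal A I"
    and P: "P \<in> A" "P o\<^sub>L P = P" and S: "S \<in> I" "norm (P - S) < 1"
  shows "P \<in> I"
proof -
  define E where "E = P - S"
  define X where "X k = ((\<lambda>Y. Y o\<^sub>L E) ^^ k) P" for k
  have SA: "S \<in> A" using I S by (auto simp: closed_ideal_def)
  then have EA: "E \<in> A"
    unfolding E_def using A P by (intro cstar_subalgebra_diff)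
  have XA: "X k \<in> A" for k
    using A P EA by (induction k) (auto simp: X_def cstar_subalgebra_def)
  have PX: "P - X k \<in> I" for k
  proof (induction k)
    case 0
    then show ?case using I by (simp add: X_def closed_ideal_def op_subspace_def)
  next
    case (Suc k)
    have "P - X (Suc k) = ((P - X k) o\<^sub>L P) + (X k o\<^sub>L S)"
      using P(2) by (intro blinfun_eqI) (simp add: X_def E_def blinfun.add_left blinfun.diff_left
          blinfun.diff_right, metis blinfun_apply_blinfun_compose)
    moreover have "(P - X k) o\<^sub>L P \<in> I" "X k o\<^sub>L S \<in> I"
      using I Suc P S XA by (auto simp: closed_ideal_def)
    ultimately show ?case
      using I by (simp add: closed_ideal_def op_subspace_def)
  qed
  have "norm (X k) \<le> norm P * norm E ^ k" for k
  proof (induction k)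
    case (Suc k)
    have "norm (X (Suc k)) \<le> norm (X k) * norm E"
      by (simp add: X_def norm_blinfun_compose)
    also have "\<dots> \<le> norm P * norm E ^ k * norm E"
      using Suc by (intro mult_right_mono) auto
    finally show ?case by (simp add: mult_ac)
  qed (simp add: X_def)
  moreover have "(\<lambda>k. norm P * norm E ^ k) \<longlonglongrightarrow> norm P * 0"
    using S(2) by (intro tendsto_mult_left LIMSEQ_power_zero) (simp add: E_def)
  ultimately have "X \<longlonglongrightarrow> 0"
    by (intro Lim_null_comparison[of X "\<lambda>k. norm P * norm E ^ k"]) auto
  then have "(\<lambda>k. P - X k) \<longlonglongrightarrow> P - 0"
    by (intro tendsto_diff tendsto_const)
  then show ?thesis
    using closed_sequentially[of I "\<lambda>k. P - X k" P] PX I by (simp add: closed_ideal_def)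
qed

lemma norm_orth_idempotent_le:
  assumes "is_adjoint P P" "P o\<^sub>L P = P"
  shows "norm P \<le> 1"
proof (rule norm_blinfun_bound)
  fix x
  have "P (P x) = P x"
    using assms(2) by (metis blinfun_apply_blinfun_compose)
  then have "cinner (P x) (P x) = cinner x (P x)"
    using assms(1) by (metis is_adjoint_def)
  then have "(norm (P x))\<^sup>2 = cmod (cinner x (P x))"
    by (metis cinner_self norm_of_real abs_power2)
  also have "\<dots> \<le> norm x * norm (P x)"
    by (rule Cauchy_Schwarz_cinner)
  finally show "norm (P x) \<le> 1 * norm x"
    by (cases "P x = 0") (auto simp: power2_eq_square)
qed simp

lemma norm_ell2_indicator: "norm (ell2_indicator x) = 1"
proof -
  have "complex_of_real ((norm (ell2_indicator x))\<^sup>2) = complex_of_real 1"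
    unfolding cinner_self[symmetric] cinner_ell2_indicator by simp
  then have "(norm (ell2_indicator x))\<^sup>2 = 1"
    by (simp only: of_real_eq_iff)
  then show ?thesis by (simp add: power2_eq_1_iff) (metis norm_ge_zero neg_0_le_iff_le not_one_le_zero)
qed

lemma op_span_compress:
  assumes G: "\<And>g. g \<in> G \<Longrightarrow> \<exists>d e. g = cyl_isometry d e \<and> length d = length e"
    and B: "B \<in> op_span G"
  shows "\<exists>N. \<forall>c. N \<le> length c \<longrightarrow> (\<exists>\<mu>. cyl_proj c o\<^sub>L (B o\<^sub>L cyl_proj c) = scaleC_op \<mu> (cyl_proj c))"
  using B
proof induction
  case zero
  have "cyl_proj c o\<^sub>L (0 o\<^sub>L cyl_proj c) = scaleC_op 0 (cyl_proj c)" for c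
    by (simp add: comp_simps scaleC_op_simps)
  then show ?case by blast
next
  case (add g T k)
  obtain d e where g: "g = cyl_isometry d e" "length d = length e"
    using G add.hyps by blast
  obtain N where N: "\<forall>c. N \<le> length c \<longrightarrow> (\<exists>\<mu>. cyl_proj c o\<^sub>L (T o\<^sub>L cyl_proj c) = scaleC_op \<mu> (cyl_proj c))"
    using add.IH by blast
  have "\<exists>\<mu>. cyl_proj c o\<^sub>L ((scaleC_op k g + T) o\<^sub>L cyl_proj c) = scaleC_op \<mu> (cyl_proj c)"
    if c: "max N (length e) \<le> length c" for c
  proof -
    obtain \<mu> where \<mu>: "cyl_proj c o\<^sub>L (T o\<^sub>L cyl_proj c) = scaleC_op \<mu> (cyl_proj c)"
      using N c by auto
    obtain \<nu> where \<nu>: "cyl_proj c o\<^sub>L (g o\<^sub>L cyl_proj c) = scaleC_op \<nu> (cyl_proj c)"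
      using cyl_proj_compress[OF g(2), of c] c g(1) by auto
    have "cyl_proj c o\<^sub>L ((scaleC_op k g + T) o\<^sub>L cyl_proj c)
        = scaleC_op k (scaleC_op \<nu> (cyl_proj c)) + scaleC_op \<mu> (cyl_proj c)"
      by (simp add: comp_simps scaleC_op_comp comp_scaleC_op cyl_proj_bounded_ops \<mu> \<nu>)
    also have "\<dots> = scaleC_op (k * \<nu> + \<mu>) (cyl_proj c)"
      by (intro blinfun_eqI) (simp add: blinfun.add_left scaleC_scaleC scaleC_add_left)
    finally show ?thesis by blast
  qed
  then show ?case by blast
qed

text \<open>
  For \<open>R = T T\<^sup>*\<close> in the ideal the diagonal coefficient at \<open>x\<close> is \<open>\<parallel>T\<^sup>* \<delta>\<^sub>x\<parallel>\<^sup>2\<close>, which is nonzero for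
  some \<open>x\<close>. Compressing to a long initial segment of \<open>x\<close> turns an approximation of \<open>R\<close> into a
  scalar close to this coefficient.
\<close>

lemma closed_ideal_contains_cyl_proj:
  assumes A: "cstar_subalgebra A" and adj: "\<And>T. T \<in> A \<Longrightarrow> \<exists>S. is_adjoint S T"
    and dense: "A \<subseteq> closure (op_span G)"
    and G: "\<And>g. g \<in> G \<Longrightarrow> \<exists>d e. g = cyl_isometry d e \<and> length d = length e"
    and projs: "cyl_projs \<subseteq> A"
    and I: "closed_ideal A I" "I \<noteq> {0}"
  shows "\<exists>c. 1 \<le> length c \<and> cyl_proj c \<in> I"
proof -
  obtain T where T: "T \<in> I" "T \<noteq> 0"
    using I by (auto simp: closed_ideal_def op_subspace_def)
  then have TA: "T \<in> A" using I by (auto simp: closed_ideal_def)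
  then obtain T' where T': "is_adjoint T' T" using adj by blast
  have T'A: "T' \<in> A" using A TA T' by (auto simp: cstar_subalgebra_def)
  define R where "R = T o\<^sub>L T'"
  have R: "R \<in> I" "R \<in> A"
    using I T T'A by (auto simp: R_def closed_ideal_def)
  obtain \<xi> where "T \<xi> \<noteq> 0"
    using T(2) by (metis blinfun_eqI zero_blinfun.rep_eq)
  then obtain x where x: "ell2_fun (T \<xi>) x \<noteq> 0"
    by (metis ell2_eqI zero_ell2.rep_eq)
  define \<delta> where "\<delta> = ell2_indicator x"
  define l where "l = (norm (T' \<delta>))\<^sup>2"
  have "cinner \<xi> (T' \<delta>) \<noteq> 0"
    using x T' by (simp add: \<delta>_def is_adjoint_def cinner_ell2_indicator flip: is_adjoint_def)
      (metis cinner_ell2_indicator is_adjoint_def)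
  then have "T' \<delta> \<noteq> 0" by auto
  then have "0 < l" by (simp add: l_def)
  have "cinner (R \<delta>) \<delta> = cinner (T' \<delta>) (T' \<delta>)"
    using T' by (simp add: R_def is_adjoint_def)
  then have Rx: "ell2_fun (R \<delta>) x = complex_of_real l"
    by (simp add: l_def cinner_self \<delta>_def cinner_ell2_indicator)
  have "R \<in> closure (op_span G)" using R dense by blast
  then obtain B where B: "B \<in> op_span G" "norm (B - R) < l / 2"
    using \<open>0 < l\<close> unfolding closure_approachable dist_norm by (meson half_gt_zero)
  obtain N where N: "\<forall>c. N \<le> length c \<longrightarrow> (\<exists>\<mu>. cyl_proj c o\<^sub>L (B o\<^sub>L cyl_proj c) = scaleC_op \<mu> (cyl_proj c))"
    using op_span_compress[OF G B(1)] by blast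
  \<comment> \<open>\<open>Suc N\<close> instead of \<open>N\<close>, because the tuple must not be empty\<close>
  define c where "c = map x [0..<Suc N]"
  define P where "P = cyl_proj c"
  have len: "length c = Suc N" by (simp add: c_def)
  have xc: "x \<in> cyl c" by (simp add: c_def cyl_def del: upt_Suc)
  have "P \<in> cyl_projs"
    unfolding P_def cyl_projs_def using len by (intro CollectI exI[of _ c]) simp
  then have PA: "P \<in> A"
    using projs by (rule set_mp[rotated])
  obtain \<mu> where \<mu>: "P o\<^sub>L (B o\<^sub>L P) = scaleC_op \<mu> P"
    using N len unfolding P_def by (metis le_SucI order_refl)
  have "P \<delta> = \<delta>"
    using xc by (intro ell2_eqI) (auto simp: P_def \<delta>_def cyl_proj_apply)
  then have "P (B \<delta>) = \<mu> *\<^sub>C \<delta>"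
    using \<mu> by (metis blinfun_apply_blinfun_compose scaleC_op_apply)
  then have "ell2_fun (P (B \<delta>)) x = \<mu>"
    by (simp add: scaleC_ell2.rep_eq \<delta>_def)
  then have "ell2_fun (B \<delta>) x = \<mu>"
    using xc by (simp add: P_def cyl_proj_apply)
  then have "\<mu> - l = ell2_fun ((B - R) \<delta>) x"
    using Rx by (simp add: blinfun.diff_left minus_ell2.rep_eq)
  then have "cmod (\<mu> - l) \<le> norm ((B - R) \<delta>)"
    using norm_ell2_coord by metis
  also have "\<dots> \<le> norm (B - R)"
    using norm_blinfun[of "B - R" \<delta>] by (simp add: \<delta>_def norm_ell2_indicator)
  finally have "cmod (\<mu> - l) < l / 2"
    using B(2) by simp
  moreover have "l \<le> cmod (\<mu> - l) + cmod \<mu>"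
    using norm_triangle_ineq4[of \<mu> "\<mu> - l"] \<open>0 < l\<close> by (simp add: add.commute)
  ultimately have \<mu>l: "l / 2 < cmod \<mu>" by simp
  then have \<mu>0: "\<mu> \<noteq> 0" using \<open>0 < l\<close> by auto
  define S where "S = scaleC_op (1 / \<mu>) (P o\<^sub>L (R o\<^sub>L P))"
  have "S \<in> I"
    using I R PA by (auto simp: S_def closed_ideal_def op_subspace_def)
  moreover have "norm (P - S) < 1"
  proof -
    have "P - S = scaleC_op (1 / \<mu>) (scaleC_op \<mu> P) - S"
      using \<mu>0 by (simp add: scaleC_op_simps)
    also have "\<dots> = scaleC_op (1 / \<mu>) (P o\<^sub>L ((B - R) o\<^sub>L P))"
      unfolding \<mu>[symmetric] S_def scaleC_op_diff_right[symmetric]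
      by (intro arg_cong[where f = "scaleC_op _"] blinfun_eqI) (simp add: blinfun.diff_left blinfun.diff_right)
    finally have "norm (P - S) \<le> cmod (1 / \<mu>) * norm (P o\<^sub>L ((B - R) o\<^sub>L P))"
      using norm_scaleC_op_le by metis
    also have "norm (P o\<^sub>L ((B - R) o\<^sub>L P)) \<le> norm P * (norm (B - R) * norm P)"
      by (meson norm_blinfun_compose mult_left_mono norm_ge_zero order_trans)
    also have "\<dots> \<le> 1 * (norm (B - R) * 1)"
      unfolding P_def using norm_orth_idempotent_le[OF cyl_proj_adjoint cyl_proj_idem, of c]
      by (intro mult_mono) auto
    finally have "norm (P - S) \<le> norm (B - R) / cmod \<mu>"
      by (simp add: norm_divide divide_right_mono field_simps)
    also have "\<dots> < 1"
      using B(2) \<mu>l \<mu>0 by (simp add: field_simps)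
    finally show ?thesis .
  qed
  moreover have "P o\<^sub>L P = P"
    by (simp add: P_def cyl_proj_idem)
  ultimately have "P \<in> I"
    using idempotent_in_closed_ideal[OF A I(1) PA] by blast
  then show ?thesis
    using len unfolding P_def by (intro exI[of _ c]) simp
qed

section \<open>Cyclic vectors and countable supports\<close>

text \<open>
  The closure of the orbit is an invariant subspace, and it contains the nonzero vector \<open>\<pi>(T) v\<close>.
\<close>

lemma irreducible_cyclic:
  assumes A: "cstar_subalgebra A" and irr: "irreducible_representation A \<pi>"
    and v: "T \<in> A" "\<pi> T v \<noteq> 0"
  shows "x \<in> closure ((\<lambda>T. \<pi> T v) ` A)"
proof -
  define M where "M = closure ((\<lambda>T. \<pi> T v) ` A)"
  have rep: "star_representation A \<pi>"
    using irr by (simp add: irreducible_representation_def)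
  \<comment> \<open>lift sequences in the orbit to sequences in the algebra, and conversely\<close>
  have seq: "\<exists>s. (\<forall>k. s k \<in> A) \<and> (\<lambda>k. \<pi> (s k) v) \<longlonglongrightarrow> x" if x: "x \<in> M" for x
  proof -
    obtain u where u: "\<forall>k. u k \<in> (\<lambda>T. \<pi> T v) ` A" "u \<longlonglongrightarrow> x"
      using x unfolding M_def closure_sequential by auto
    then have "\<forall>k. \<exists>S. S \<in> A \<and> u k = \<pi> S v" by auto
    then have "\<exists>s. \<forall>k. s k \<in> A \<and> u k = \<pi> (s k) v"
      by (rule choice)
    then obtain s where s: "\<forall>k. s k \<in> A \<and> u k = \<pi> (s k) v" ..
    then have "u = (\<lambda>k. \<pi> (s k) v)" by auto
    then show ?thesis using s u(2) by auto
  qed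
  have lim: "x \<in> M" if "\<And>k. s k \<in> A" "(\<lambda>k. \<pi> (s k) v) \<longlonglongrightarrow> x" for s x
  proof -
    have "\<pi> (s k) v \<in> M" for k
      using that(1) closure_subset[of "(\<lambda>T. \<pi> T v) ` A"] unfolding M_def by auto
    moreover have "closed M" by (simp add: M_def)
    ultimately show ?thesis
      using that(2) closed_sequentially[of M "\<lambda>k. \<pi> (s k) v" x] by simp
  qed
  have sub: "0 \<in> A" "S \<in> A \<Longrightarrow> T \<in> A \<Longrightarrow> S + T \<in> A" "T \<in> A \<Longrightarrow> scaleC_op c T \<in> A"
    "S \<in> A \<Longrightarrow> T \<in> A \<Longrightarrow> S o\<^sub>L T \<in> A" for S T c
    using A by (simp_all add: cstar_subalgebra_def op_subspace_def)
  have "closed_csubspace M"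
    unfolding closed_csubspace_def
  proof (intro conjI ballI allI)
    show "0 \<in> M"
      by (rule lim[of "\<lambda>_. 0"]) (simp_all add: sub star_representation_zero[OF rep])
    show "closed M" by (simp add: M_def)
  next
    fix x y assume "x \<in> M" "y \<in> M"
    then obtain s t where st: "\<forall>k. s k \<in> A" "(\<lambda>k. \<pi> (s k) v) \<longlonglongrightarrow> x" "\<forall>k. t k \<in> A" "(\<lambda>k. \<pi> (t k) v) \<longlonglongrightarrow> y"
      using seq by meson
    have "\<pi> (s k + t k) = \<pi> (s k) + \<pi> (t k)" for k
      using st rep unfolding star_representation_def by blast
    then have "(\<lambda>k. \<pi> (s k + t k) v) \<longlonglongrightarrow> x + y"
      using tendsto_add[OF st(2,4)] by (simp add: blinfun.add_left)
    then show "x + y \<in> M"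
      by (rule lim[rotated]) (use st sub in blast)
  next
    fix c x assume "x \<in> M"
    then obtain s where s: "\<forall>k. s k \<in> A" "(\<lambda>k. \<pi> (s k) v) \<longlonglongrightarrow> x"
      using seq by meson
    have "\<pi> (scaleC_op c (s k)) = scaleC_op c (\<pi> (s k))" for k
      using s rep unfolding star_representation_def by blast
    then have "(\<lambda>k. \<pi> (scaleC_op c (s k)) v) \<longlonglongrightarrow> c *\<^sub>C x"
      using bounded_linear.tendsto[OF bounded_linear_scaleC s(2), of c] by simp
    then show "c *\<^sub>C x \<in> M"
      by (rule lim[rotated]) (use s sub in blast)
  qed
  moreover have "\<pi> S x \<in> M" if S: "S \<in> A" and "x \<in> M" for S x
  proof -
    obtain s where s: "\<forall>k. s k \<in> A" "(\<lambda>k. \<pi> (s k) v) \<longlonglongrightarrow> x"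
      using seq \<open>x \<in> M\<close> by meson
    have "\<pi> (S o\<^sub>L s k) = \<pi> S o\<^sub>L \<pi> (s k)" for k
      using S s rep unfolding star_representation_def by blast
    then have "(\<lambda>k. \<pi> (S o\<^sub>L s k) v) \<longlonglongrightarrow> \<pi> S x"
      using blinfun.tendsto[OF tendsto_const s(2), of "\<pi> S"] by simp
    then show ?thesis
      by (rule lim[rotated]) (use S s sub in blast)
  qed
  moreover have "\<pi> T v \<in> M"
    using v(1) closure_subset[of "(\<lambda>T. \<pi> T v) ` A"] unfolding M_def by auto
  ultimately have "M = UNIV"
    using irr v(2) unfolding irreducible_representation_def by blast
  then show ?thesis by (simp add: M_def)
qed

lemma cinner_sum_right: "cinner (x::'a::chilbert_space) (sum w F) = (\<Sum>c\<in>F. cinner x (w c))"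
  by (induction F rule: infinite_finite_induct) (simp_all add: cinner_add_right)

lemma cinner_sum_left: "cinner (sum w F) (x::'a::chilbert_space) = (\<Sum>c\<in>F. cinner (w c) x)"
  by (induction F rule: infinite_finite_induct) (simp_all add: cinner_add_left)

text \<open>
  Bessel's inequality: the vectors \<open>w c\<close> behave like orthogonal projections of \<open>v\<close>, so their squared
  norms are summable.
\<close>

lemma countable_orthogonal_components:
  fixes w :: "'i \<Rightarrow> 'k::chilbert_space"
  assumes orth: "\<And>c d. c \<in> C \<Longrightarrow> d \<in> C \<Longrightarrow> c \<noteq> d \<Longrightarrow> cinner (w c) (w d) = 0"
    and comp: "\<And>c. c \<in> C \<Longrightarrow> cinner v (w c) = cinner (w c) (w c)"
  shows "countable {c \<in> C. w c \<noteq> 0}"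
proof -
  have bessel: "(\<Sum>c\<in>F. (norm (w c))\<^sup>2) \<le> (norm v)\<^sup>2" if F: "finite F" "F \<subseteq> C" for F
  proof -
    define s where "s = sum w F"
    define q where "q = (\<Sum>c\<in>F. cinner (w c) (w c))"
    have q: "q = complex_of_real (\<Sum>c\<in>F. (norm (w c))\<^sup>2)"
      by (simp add: q_def cinner_self)
    have sw: "cinner s (w c) = cinner (w c) (w c)" if "c \<in> F" for c
    proof -
      have "cinner s (w c) = (\<Sum>d\<in>F. if d = c then cinner (w c) (w c) else 0)"
        unfolding s_def cinner_sum_left using F that by (intro sum.cong refl) (auto intro: orth)
      then show ?thesis
        using F that by simp
    qed
    have ss: "cinner s s = q"
    proof -
      have "cinner s s = (\<Sum>c\<in>F. cinner s (w c))"
        by (subst (2) s_def) (rule cinner_sum_right)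
      then show ?thesis by (simp add: sw q_def)
    qed
    have vs: "cinner v s = q"
      unfolding s_def cinner_sum_right q_def using F comp by (intro sum.cong refl) auto
    then have sv: "cinner s v = q"
      by (subst cinner_commute) (simp add: q)
    have "complex_of_real ((norm (v - s))\<^sup>2) = cinner v v - q"
      unfolding cinner_self[symmetric] by (simp add: cinner_diff_left cinner_diff_right ss vs sv)
    then have "complex_of_real ((norm (v - s))\<^sup>2) = complex_of_real ((norm v)\<^sup>2 - (\<Sum>c\<in>F. (norm (w c))\<^sup>2))"
      by (simp only: q cinner_self of_real_diff)
    then have "(norm (v - s))\<^sup>2 = (norm v)\<^sup>2 - (\<Sum>c\<in>F. (norm (w c))\<^sup>2)"
      by (simp only: of_real_eq_iff)
    then show ?thesis
      by (smt (verit) zero_le_power2)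
  qed
  have "(\<lambda>c. (norm (w c))\<^sup>2) summable_on C"
    by (rule nonneg_bdd_above_summable_on) (auto intro!: bdd_aboveI2 bessel)
  from summable_countable_real[OF this] show ?thesis by simp
qed

text \<open>
  For each fixed length the projections are mutually orthogonal; there are countably many lengths.
\<close>

lemma countable_cyl_projs_not_killing:
  assumes A: "cstar_subalgebra A" and projs: "cyl_projs \<subseteq> A" and rep: "star_representation A \<pi>"
  shows "countable {c. 1 \<le> length c \<and> \<pi> (cyl_proj c) v \<noteq> 0}"
proof -
  have level: "countable {c. length c = Suc m \<and> \<pi> (cyl_proj c) v \<noteq> 0}" for m
  proof -
    define C where "C = {c :: real list. length c = Suc m}"
    have inA: "cyl_proj c \<in> A" if "c \<in> C" for c
    proof -
      have "cyl_proj c \<in> cyl_projs"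
        using that unfolding C_def cyl_projs_def by auto
      then show ?thesis using projs by (rule set_mp[rotated])
    qed
    have adj: "cinner (\<pi> (cyl_proj c) x) y = cinner x (\<pi> (cyl_proj c) y)" if "c \<in> C" for c x y
      using rep inA[OF that] cyl_proj_adjoint unfolding star_representation_def is_adjoint_def by blast
    have mult: "\<pi> (cyl_proj c) (\<pi> (cyl_proj d) x) = \<pi> (cyl_proj c o\<^sub>L cyl_proj d) x"
      if "c \<in> C" "d \<in> C" for c d x
      using rep inA that unfolding star_representation_def by (metis blinfun_apply_blinfun_compose)
    have "0 \<in> A" using A by (simp add: cstar_subalgebra_def op_subspace_def)
    then have "\<pi> 0 = 0" using rep by (intro star_representation_zero)
    then have "countable {c \<in> C. \<pi> (cyl_proj c) v \<noteq> 0}"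
      by (intro countable_orthogonal_components[where v = v])
        (simp_all add: adj mult cyl_proj_orthogonal cyl_proj_idem, auto simp: C_def cyl_proj_orthogonal)
    then show ?thesis by (simp add: C_def)
  qed
  have "{c. 1 \<le> length c \<and> \<pi> (cyl_proj c) v \<noteq> 0} = (\<Union>m. {c. length c = Suc m \<and> \<pi> (cyl_proj c) v \<noteq> 0})"
    by (auto simp: Suc_le_eq gr0_conv_Suc)
  then show ?thesis
    using level by simp
qed

section \<open>Linked tuples\<close>

lemma extends_append: "extends x y \<Longrightarrow> \<exists>z. x = y @ z"
proof -
  assume "extends x y"
  then have "take (length y) x = y"
    by (intro nth_equalityI) (auto simp: extends_def)
  then have "x = y @ drop (length y) x"
    using append_take_drop_id[of "length y" x] by (simp only:)
  then show ?thesis ..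
qed

context transfinite_construction
begin

lemma step_lengths:
  assumes "\<sigma> \<in> Field r"
  shows "length (a \<sigma>) = n \<sigma>" "length (b \<sigma>) = n \<sigma>" "1 \<le> n \<sigma>"
    and step_last: "b \<sigma> ! (n \<sigma> - 1) = a \<sigma> ! (n \<sigma> - 1)"
    and step_fresh: "a \<sigma> ! (n \<sigma> - 1) \<notin> S_set r n a b \<sigma>" "a \<sigma> ! (n \<sigma> - 1) \<notin> T_set r \<phi>\<^sub>2 n \<sigma>"
  using step[OF assms] by auto

text \<open>
  Surjectivity of \<open>\<phi>\<^sub>1\<close> means that every pair of tuples is treated at some stage.
\<close>

lemma common_extension:
  assumes "1 \<le> length c" "1 \<le> length d"
  shows "\<exists>\<sigma>\<in>Field r. \<exists>y z. a \<sigma> = c @ y \<and> b \<sigma> = d @ z"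
proof -
  have "(cyl_proj c, cyl_proj d) \<in> cyl_projs \<times> cyl_projs"
    using assms by (auto simp: cyl_projs_def)
  then obtain \<sigma> where \<sigma>: "\<sigma> \<in> Field r" "\<phi>\<^sub>1 \<sigma> = (cyl_proj c, cyl_proj d)"
    using bij_\<phi>\<^sub>1 unfolding bij_betw_def by (metis imageE)
  obtain a' b' where ab: "\<phi>\<^sub>1 \<sigma> = (cyl_proj a', cyl_proj b')" "extends (a \<sigma>) a'" "extends (b \<sigma>) b'"
    using step[OF \<sigma>(1)] by auto
  have "a' = c" "b' = d"
    using ab(1) \<sigma>(2) injD[OF inj_cyl_proj] by auto
  then show ?thesis
    using ab(2,3) \<sigma>(1) by (auto dest!: extends_append)
qed

lemma infinite_Field: "infinite (Field r)"
  using card_of_ordIso_finite_Field[OF card_order card_continuum] by (simp add: infinite_UNIV_char_0)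

text \<open>
  An infinite cardinal has no largest element.
\<close>

lemma exists_above: "\<tau> \<in> Field r \<Longrightarrow> \<exists>\<sigma>\<in>Field r. \<tau> \<in> below r \<sigma>"
  using infinite_Card_order_limit[OF card_order infinite_Field] by (auto simp: below_def)

lemma below_trans:
  assumes "\<rho> \<in> Field r" "\<tau> \<in> below r \<sigma>" "\<tau> \<notin> below r \<rho>"
  shows "\<rho> \<in> below r \<sigma>"
proof -
  have wo: "Well_order r"
    using card_order by (rule card_order_on_well_order_on)
  then have refl: "refl_on (Field r) r" and trans: "trans r" and antisym: "antisym r"
    and total: "total_on (Field r) r"
    by (simp_all add: well_order_on_def linear_order_on_def partial_order_on_def preorder_on_def)
  have \<tau>\<sigma>: "(\<tau>, \<sigma>) \<in> r" "\<tau> \<noteq> \<sigma>"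
    using assms(2) by (simp_all add: below_def)
  then have "\<tau> \<in> Field r"
    by (auto intro: FieldI1)
  have \<rho>\<tau>: "(\<rho>, \<tau>) \<in> r"
  proof (cases "\<rho> = \<tau>")
    case True
    then show ?thesis
      using refl_onD[OF refl assms(1)] by simp
  next
    case False
    then have "(\<rho>, \<tau>) \<in> r \<or> (\<tau>, \<rho>) \<in> r"
      using total assms(1) \<open>\<tau> \<in> Field r\<close> by (simp add: total_on_def)
    then show ?thesis
      using False assms(3) by (auto simp: below_def)
  qed
  have "(\<rho>, \<sigma>) \<in> r"
    using trans \<rho>\<tau> \<tau>\<sigma>(1) by (rule transD)
  moreover have "\<rho> \<noteq> \<sigma>"
    using antisymD[OF antisym] \<rho>\<tau> \<tau>\<sigma> by auto
  ultimately show ?thesis by (simp add: below_def)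
qed

text \<open>
  The action of \<open>V\<^sub>\<sigma>\<close> and of its adjoint on cylinders inside its domain.
\<close>

definition swap :: "real list \<Rightarrow> real list \<Rightarrow> bool" where
  "swap x x' \<longleftrightarrow> (\<exists>\<sigma>\<in>Field r. \<exists>y. (x = a \<sigma> @ y \<and> x' = b \<sigma> @ y) \<or> (x = b \<sigma> @ y \<and> x' = a \<sigma> @ y))"

lemma swap_forward: "\<sigma> \<in> Field r \<Longrightarrow> swap (a \<sigma> @ y) (b \<sigma> @ y)"
  unfolding swap_def by blast

lemma swap_backward: "\<sigma> \<in> Field r \<Longrightarrow> swap (b \<sigma> @ y) (a \<sigma> @ y)"
  unfolding swap_def by blast

abbreviation linked :: "real list \<Rightarrow> real list \<Rightarrow> bool" where
  "linked \<equiv> swap\<^sup>*\<^sup>*"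

lemma linked_length: "linked d e \<Longrightarrow> length d = length e"
  by (induction rule: rtranclp_induct) (auto simp: swap_def step_lengths)

lemma linked_sym: "linked d e \<Longrightarrow> linked e d"
  using symp_rtranclp[of swap] by (auto simp: symp_def swap_def)

lemma linked_append: "linked d e \<Longrightarrow> linked (d @ z) (e @ z)"
proof (induction rule: rtranclp_induct)
  case (step e e')
  then obtain \<sigma> y where "\<sigma> \<in> Field r"
    and "(e = a \<sigma> @ y \<and> e' = b \<sigma> @ y) \<or> (e = b \<sigma> @ y \<and> e' = a \<sigma> @ y)"
    unfolding swap_def by blast
  then have "swap (e @ z) (e' @ z)"
    using swap_forward[of \<sigma> "y @ z"] swap_backward[of \<sigma> "y @ z"] by auto
  then show ?case using step by simp
qed simp

text \<open>
  The induction is over the swaps, simultaneously for all stages \<open>\<sigma>\<close> above \<open>\<tau>\<close>. Initially the claim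
  holds because the fresh entry avoids \<open>T\<^sub>\<sigma>\<close>. A swap at stage \<open>\<rho>\<close> needs a tuple that has the fresh
  entry of \<open>\<rho>\<close>, so by the claim itself \<open>\<rho>\<close> is not above \<open>\<tau>\<close>; hence \<open>\<rho> < \<sigma>\<close>, and whatever this
  swap writes at position \<open>n\<^sub>\<sigma>\<close> belongs to \<open>S\<^sub>\<sigma>\<close>, which the fresh entry of \<open>\<sigma>\<close> avoids as well.
\<close>

lemma linked_avoids:
  assumes "linked d e" "cyl_proj d \<in> \<phi>\<^sub>2 \<tau>" "\<tau> \<in> Field r"
    and "\<sigma> \<in> Field r" "\<tau> \<in> below r \<sigma>" "n \<sigma> \<le> length e"
  shows "e ! (n \<sigma> - 1) \<noteq> a \<sigma> ! (n \<sigma> - 1)"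
  using assms(1,4-6)
proof (induction arbitrary: \<sigma> rule: rtranclp_induct)
  case base
  then have "d ! (n \<sigma> - 1) \<in> T_set r \<phi>\<^sub>2 n \<sigma>"
    using assms(2) unfolding T_set_def by (intro CollectI exI[of _ d] exI[of _ \<tau>]) simp
  then show ?case
    using step_fresh(2)[OF base(1)] by auto
next
  case (step e e')
  obtain \<rho> y where \<rho>: "\<rho> \<in> Field r"
    and ee: "(e = a \<rho> @ y \<and> e' = b \<rho> @ y) \<or> (e = b \<rho> @ y \<and> e' = a \<rho> @ y)"
    using step.hyps(2) unfolding swap_def by blast
  note l = step_lengths[OF \<rho>]
  have len: "length e = length e'" "n \<rho> \<le> length e"
    using ee l by auto
  have at: "e ! (n \<rho> - 1) = a \<rho> ! (n \<rho> - 1)"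
    using ee l step_last[OF \<rho>] by (auto simp: nth_append)
  have "\<tau> \<notin> below r \<rho>"
    using step.IH[OF \<rho>] at len(2) by blast
  then have below: "\<rho> \<in> below r \<sigma>"
    using \<rho> step.prems(2) by (rule below_trans[rotated 2])
  show ?case
  proof (cases "n \<sigma> \<le> n \<rho>")
    case True
    have "n \<sigma> - 1 < n \<rho>"
      using True step_lengths(3)[OF step.prems(1)] by simp
    then have "e' ! (n \<sigma> - 1) = a \<rho> ! (n \<sigma> - 1) \<or> e' ! (n \<sigma> - 1) = b \<rho> ! (n \<sigma> - 1)"
      using ee l by (auto simp: nth_append)
    then have "e' ! (n \<sigma> - 1) \<in> S_set r n a b \<sigma>"
      using True below unfolding S_set_def by blast
    then show ?thesis
      using step_fresh(1)[OF step.prems(1)] by auto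
  next
    case False
    then have "e' ! (n \<sigma> - 1) = e ! (n \<sigma> - 1)"
      using ee l by (auto simp: nth_append)
    then show ?thesis
      using step.IH[OF step.prems(1,2)] step.prems(3) len by simp
  qed
qed

section \<open>The algebra as a closed span of linking isometries\<close>

abbreviation alg :: "operator set" where
  "alg \<equiv> cstar_generated (cyl_projs \<union> isometries r a b)"

text \<open>
  The bound on the length leaves out the empty tuple, whose isometry is the identity operator.
\<close>

definition links :: "operator set" where
  "links = {cyl_isometry d e | d e. linked d e \<and> 1 \<le> length d}"

lemma linksI: "linked d e \<Longrightarrow> 1 \<le> length d \<Longrightarrow> cyl_isometry d e \<in> links"
  unfolding links_def by blast

lemma generators_bounded: "cyl_projs \<union> isometries r a b \<subseteq> bounded_ops"
  by (auto simp: cyl_projs_def isometries_def cyl_proj_bounded_ops cyl_isometry_bounded_ops step_lengths)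

lemma cstar_subalgebra_alg: "cstar_subalgebra alg"
  using generators_bounded by (rule cstar_subalgebra_generated)

lemma generators_in_alg: "cyl_projs \<union> isometries r a b \<subseteq> alg"
  by (auto simp: cstar_generated_iff)

lemma cyl_proj_in_alg: "1 \<le> length d \<Longrightarrow> cyl_proj d \<in> alg"
  using generators_in_alg by (auto simp: cyl_projs_def)

lemma alg_comp: "S \<in> alg \<Longrightarrow> T \<in> alg \<Longrightarrow> S o\<^sub>L T \<in> alg"
  using cstar_subalgebra_alg unfolding cstar_subalgebra_def by blast

lemma alg_adjoint: "T \<in> alg \<Longrightarrow> is_adjoint S T \<Longrightarrow> S \<in> alg"
  using cstar_subalgebra_alg unfolding cstar_subalgebra_def by blast

lemma swap_isometry_in_alg:
  assumes "swap d e"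
  shows "cyl_isometry d e \<in> alg"
proof -
  obtain \<sigma> y where \<sigma>: "\<sigma> \<in> Field r"
    and de: "(d = a \<sigma> @ y \<and> e = b \<sigma> @ y) \<or> (d = b \<sigma> @ y \<and> e = a \<sigma> @ y)"
    using assms unfolding swap_def by blast
  note l = step_lengths[OF \<sigma>]
  have V: "cyl_isometry (a \<sigma>) (b \<sigma>) \<in> alg"
    using generators_in_alg \<sigma> by (auto simp: isometries_def)
  have "cyl_isometry (a \<sigma>) (b \<sigma>) o\<^sub>L cyl_isometry (a \<sigma> @ y) (a \<sigma> @ y) = cyl_isometry (a \<sigma> @ y) (b \<sigma> @ y)"
    using l by (intro cyl_isometry_comp_shorter) auto
  moreover have "cyl_isometry (a \<sigma> @ y) (a \<sigma> @ y) \<in> alg"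
    unfolding cyl_isometry_self using l by (intro cyl_proj_in_alg) simp
  ultimately have ab: "cyl_isometry (a \<sigma> @ y) (b \<sigma> @ y) \<in> alg"
    using alg_comp[OF V] by metis
  then have "cyl_isometry (b \<sigma> @ y) (a \<sigma> @ y) \<in> alg"
    by (rule alg_adjoint, intro cyl_isometry_adjoint) (simp add: l)
  then show ?thesis using ab de by auto
qed

lemma links_subset_alg: "links \<subseteq> alg"
proof -
  have "cyl_isometry d e \<in> alg" if "linked d e" "1 \<le> length d" for d e
    using that
  proof (induction rule: rtranclp_induct)
    case base
    then show ?case by (simp add: cyl_isometry_self cyl_proj_in_alg)
  next
    case (step e e')
    have "cyl_isometry e e' o\<^sub>L cyl_isometry d e = cyl_isometry d e'"
      using cyl_isometry_comp_longer[of d e e' "[]"] linked_length[OF step.hyps(1)]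
        linked_length[OF rtranclp.rtrancl_into_rtrancl[OF step.hyps]] by simp
    then show ?case
      using alg_comp[OF swap_isometry_in_alg[OF step.hyps(2)] step.IH[OF step.prems]] by simp
  qed
  then show ?thesis unfolding links_def by blast
qed

lemma links_comp:
  assumes "S \<in> links" "T \<in> links"
  shows "S o\<^sub>L T \<in> insert 0 links"
proof -
  obtain d e where T: "T = cyl_isometry d e" "linked d e" "1 \<le> length d"
    using assms by (auto simp: links_def)
  obtain e' f where S: "S = cyl_isometry e' f" "linked e' f" "1 \<le> length e'"
    using assms by (auto simp: links_def)
  note l = linked_length[OF T(2)] linked_length[OF S(2)]
  show ?thesis
    using l
  proof (cases rule: cyl_isometry_comp_cases)
    case 1
    then show ?thesis using S T by simp
  next
    case (2 y)
    have "linked (d @ y) f"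
      using linked_append[OF T(2), of y] S(2) 2(1) by simp
    then have "cyl_isometry (d @ y) f \<in> links"
      using T(3) by (intro linksI) simp_all
    then show ?thesis
      using 2(2) S(1) T(1) by simp
  next
    case (3 y)
    have "linked d (f @ y)"
      using linked_append[OF S(2), of y] T(2) 3(1) by simp
    then have "cyl_isometry d (f @ y) \<in> links"
      using T(3) by (rule linksI)
    then show ?thesis
      using 3(2) S(1) T(1) by simp
  qed
qed

lemma links_adjoint:
  assumes "T \<in> links"
  shows "\<exists>S\<in>links. is_adjoint S T"
proof -
  obtain d e where T: "T = cyl_isometry d e" "linked d e" "1 \<le> length d"
    using assms by (auto simp: links_def)
  then have "cyl_isometry e d \<in> links"
    using linked_sym[OF T(2)] linked_length[OF T(2)] by (intro linksI) simp_all
  moreover have "is_adjoint (cyl_isometry e d) T"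
    unfolding T(1) using linked_length[OF T(2)] by (rule cyl_isometry_adjoint)
  ultimately show ?thesis ..
qed

lemma alg_subset_closure: "alg \<subseteq> closure (op_span links)"
proof -
  have "links \<subseteq> bounded_ops"
    using links_subset_alg cstar_subalgebra_alg unfolding cstar_subalgebra_def by blast
  then have "cstar_subalgebra (closure (op_span links))"
    using links_comp links_adjoint by (rule cstar_subalgebra_closure_op_span(1))
  moreover have "cyl_projs \<subseteq> links"
    using linksI[OF rtranclp.rtrancl_refl] by (auto simp: cyl_projs_def cyl_isometry_self)
  moreover have "isometries r a b \<subseteq> links"
  proof
    fix V assume "V \<in> isometries r a b"
    then obtain \<sigma> where \<sigma>: "\<sigma> \<in> Field r" "V = cyl_isometry (a \<sigma>) (b \<sigma>)"
      by (auto simp: isometries_def)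
    have "swap (a \<sigma>) (b \<sigma>)"
      using swap_forward[OF \<sigma>(1), of "[]"] by simp
    then show "V \<in> links"
      unfolding \<sigma>(2) using step_lengths[OF \<sigma>(1)] by (intro linksI) auto
  qed
  moreover have "links \<subseteq> closure (op_span links)"
    using op_span_base closure_subset by blast
  ultimately show ?thesis
    unfolding cstar_generated_def by blast
qed

lemma alg_has_adjoint:
  assumes "T \<in> alg"
  shows "\<exists>S. is_adjoint S T"
proof (rule cstar_subalgebra_closure_op_span(2)[of links])
  show "links \<subseteq> bounded_ops"
    using links_subset_alg cstar_subalgebra_alg unfolding cstar_subalgebra_def by blast
  show "T \<in> closure (op_span links)"
    using assms alg_subset_closure by blast
qed (use links_comp links_adjoint in auto)

section \<open>Primeness\<close>

lemma prime_alg: "prime_cstar alg"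
  unfolding prime_cstar_def
proof (intro allI impI, elim conjE)
  fix I J
  assume I: "closed_ideal alg I" "I \<noteq> {0}" and J: "closed_ideal alg J" "J \<noteq> {0}"
  have links: "\<exists>d e. g = cyl_isometry d e \<and> length d = length e" if "g \<in> links" for g
    using that linked_length unfolding links_def by blast
  have projs: "cyl_projs \<subseteq> alg"
    using generators_in_alg by blast
  note contains = closed_ideal_contains_cyl_proj[OF cstar_subalgebra_alg alg_has_adjoint
      alg_subset_closure links projs]
  obtain c where c: "1 \<le> length c" "cyl_proj c \<in> I"
    using contains[OF _ _ I] by blast
  obtain d where d: "1 \<le> length d" "cyl_proj d \<in> J"
    using contains[OF _ _ J] by blast
  obtain \<sigma> y z where \<sigma>: "\<sigma> \<in> Field r" and ab: "a \<sigma> = c @ y" "b \<sigma> = d @ z"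
    using common_extension[OF c(1) d(1)] by blast
  note l = step_lengths[OF \<sigma>]
  let ?V = "cyl_isometry (a \<sigma>) (b \<sigma>)" and ?V' = "cyl_isometry (b \<sigma>) (a \<sigma>)"
  have V: "?V \<in> alg" "?V' \<in> alg"
    using swap_isometry_in_alg[OF swap_forward[OF \<sigma>, of "[]"]]
      swap_isometry_in_alg[OF swap_backward[OF \<sigma>, of "[]"]] by simp_all
  have ideal: "S \<in> alg \<Longrightarrow> T \<in> K \<Longrightarrow> S o\<^sub>L T \<in> K \<and> T o\<^sub>L S \<in> K"
    if "closed_ideal alg K" for K S T
    using that unfolding closed_ideal_def by blast
  have Pa: "cyl_proj (a \<sigma>) \<in> I"
    using ideal[OF I(1) cyl_proj_in_alg[of "a \<sigma>"] c(2)] cyl_proj_append_comp[of c y] l ab(1) by simp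
  \<comment> \<open>carry the projection of \<open>a\<^sub>\<sigma>\<close> over to that of \<open>b\<^sub>\<sigma>\<close> inside the ideal\<close>
  have "?V o\<^sub>L cyl_proj (a \<sigma>) = ?V"
    unfolding cyl_isometry_self[symmetric] by (rule cyl_isometry_comp_middle) (simp_all add: l)
  then have "?V \<in> I"
    using ideal[OF I(1) V(1) Pa] by simp
  moreover have "?V o\<^sub>L ?V' = cyl_proj (b \<sigma>)"
    unfolding cyl_isometry_self[symmetric] by (rule cyl_isometry_comp_middle) (simp_all add: l)
  ultimately have "cyl_proj (b \<sigma>) \<in> I"
    using ideal[OF I(1) V(2)] by metis
  moreover have "cyl_proj (b \<sigma>) \<in> J"
    using ideal[OF J(1) cyl_proj_in_alg[of "b \<sigma>"] d(2)] cyl_proj_append_comp[of d z] l ab(2) by simp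
  ultimately show "I \<inter> J \<noteq> {0}"
    using cyl_proj_nonzero[of "b \<sigma>"] by blast
qed

section \<open>Failure of primitivity\<close>

text \<open>
  On the span this is a statement about single isometries: \<open>P V\<^sub>d\<^sub>e\<close>, for \<open>P\<close> the projection of \<open>a\<^sub>\<sigma>\<close>,
  is zero or \<open>V\<^sub>f\<^sub>g\<close> with \<open>f\<close> linked to an extension \<open>g\<close> of \<open>a\<^sub>\<sigma>\<close>. Then \<open>linked_avoids\<close> excludes
  \<open>\<pi>(P\<^sub>f) v \<noteq> 0\<close>, so \<open>\<pi>(V\<^sub>f\<^sub>g) v = \<pi>(V\<^sub>f\<^sub>g) \<pi>(P\<^sub>f) v = 0\<close>.
\<close>

lemma annihilates_orbit:
  assumes rep: "star_representation alg \<pi>"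
    and support: "\<And>c. 1 \<le> length c \<Longrightarrow> \<pi> (cyl_proj c) v \<noteq> 0 \<Longrightarrow> cyl_proj c \<in> \<phi>\<^sub>2 \<tau>"
    and \<tau>: "\<tau> \<in> Field r" and \<sigma>: "\<sigma> \<in> Field r" "\<tau> \<in> below r \<sigma>"
    and T: "T \<in> alg"
  shows "\<pi> (cyl_proj (a \<sigma>)) (\<pi> T v) = 0"
proof -
  note l = step_lengths[OF \<sigma>(1)]
  let ?P = "cyl_proj (a \<sigma>)"
  have P: "?P \<in> alg"
    using l by (intro cyl_proj_in_alg) simp
  have mult: "\<pi> S (\<pi> T x) = \<pi> (S o\<^sub>L T) x" if "S \<in> alg" "T \<in> alg" for S T x
    using rep that unfolding star_representation_def by (metis blinfun_apply_blinfun_compose)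
  have plus: "\<pi> (S + T) = \<pi> S + \<pi> T" if "S \<in> alg" "T \<in> alg" for S T
    using rep that unfolding star_representation_def by blast
  have scale: "\<pi> (scaleC_op c T) = scaleC_op c (\<pi> T)" if "T \<in> alg" for c T
    using rep that unfolding star_representation_def by blast
  have sub: "op_subspace alg"
    using cstar_subalgebra_alg by (simp add: cstar_subalgebra_def)
  have zero: "\<pi> 0 = 0"
    using rep sub by (intro star_representation_zero) (auto simp: op_subspace_def)
  have kill: "\<pi> (cyl_isometry d (a \<sigma> @ y)) v = 0" if link: "linked d (a \<sigma> @ y)" for d y
  proof -
    have len: "length d = length (a \<sigma> @ y)"
      using link by (rule linked_length)
    then have d: "1 \<le> length d"
      using l by simp
    have "\<pi> (cyl_proj d) v = 0"
    proof (rule ccontr)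
      assume "\<pi> (cyl_proj d) v \<noteq> 0"
      then have "cyl_proj d \<in> \<phi>\<^sub>2 \<tau>"
        using support d by blast
      then have "(a \<sigma> @ y) ! (n \<sigma> - 1) \<noteq> a \<sigma> ! (n \<sigma> - 1)"
        using linked_avoids[OF link _ \<tau> \<sigma>] l by simp
      then show False
        using l by (simp add: nth_append)
    qed
    moreover have "cyl_isometry d (a \<sigma> @ y) o\<^sub>L cyl_proj d = cyl_isometry d (a \<sigma> @ y)"
      unfolding cyl_isometry_self[symmetric] by (rule cyl_isometry_comp_middle) (simp_all add: len)
    moreover have "cyl_isometry d (a \<sigma> @ y) \<in> alg"
      using linksI[OF link d] links_subset_alg by blast
    ultimately show ?thesis
      using mult[of "cyl_isometry d (a \<sigma> @ y)" "cyl_proj d" v] cyl_proj_in_alg[OF d] by simp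
  qed
  have kill_link: "\<pi> ?P (\<pi> g v) = 0" if link: "g \<in> links" for g
  proof -
    have g_alg: "g \<in> alg"
      using link links_subset_alg by blast
    obtain d e where g: "g = cyl_isometry d e" "linked d e"
      using link unfolding links_def by blast
    have "\<pi> (cyl_isometry (a \<sigma>) (a \<sigma>) o\<^sub>L cyl_isometry d e) v = 0"
      using linked_length[OF g(2)] refl[of "length (a \<sigma>)"]
    proof (cases rule: cyl_isometry_comp_cases)
      case 1
      then show ?thesis by (simp add: zero)
    next
      case (2 y)
      have "linked (d @ y) (a \<sigma> @ [])"
        using linked_append[OF g(2), of y] 2(1) by simp
      from kill[OF this] show ?thesis
        unfolding 2(2) by simp
    next
      case (3 y)
      have "linked d (a \<sigma> @ y)"
        using g(2) unfolding 3(1) .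
      from kill[OF this] show ?thesis
        unfolding 3(2) .
    qed
    then show ?thesis
      using mult[OF P g_alg] by (simp add: g(1) cyl_isometry_self)
  qed
  have span: "B \<in> alg \<and> \<pi> ?P (\<pi> B v) = 0" if "B \<in> op_span links" for B
    using that
  proof induction
    case zero
    then show ?case using sub by (simp add: \<open>\<pi> 0 = 0\<close> op_subspace_def)
  next
    case (add g B c)
    have g: "g \<in> alg" using add.hyps(1) links_subset_alg by blast
    then have cg: "scaleC_op c g \<in> alg" using sub by (simp add: op_subspace_def)
    have "\<pi> ?P (c *\<^sub>C \<pi> g v) = c *\<^sub>C \<pi> ?P (\<pi> g v)"
      using rep P unfolding star_representation_def bounded_ops_def by blast
    then have "\<pi> ?P (\<pi> (scaleC_op c g + B) v) = 0"
      using add.IH kill_link[OF add.hyps(1)] plus[OF cg, of B] scale[OF g]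
      by (simp add: blinfun.add_left blinfun.add_right)
    then show ?case
      using add.IH cg sub by (simp add: op_subspace_def)
  qed
  obtain s where s: "\<And>k. s k \<in> op_span links" "s \<longlonglongrightarrow> T"
    using T alg_subset_closure closure_sequential[of T "op_span links"] by auto
  have "(\<lambda>k. \<pi> (s k) v) \<longlonglongrightarrow> \<pi> T v"
    using span s(1) by (intro star_representation_tendsto[OF cstar_subalgebra_alg rep alg_has_adjoint _ T s(2)]) auto
  from blinfun.tendsto[OF tendsto_const this, of "\<pi> ?P"]
  have "(\<lambda>k. 0) \<longlonglongrightarrow> \<pi> ?P (\<pi> T v)"
    using span s(1) by simp
  then show ?thesis
    by (simp add: LIMSEQ_const_iff)
qed

lemma not_primitive_alg: "\<not> primitive_on TYPE('k::chilbert_space) alg"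
proof
  assume "primitive_on TYPE('k) alg"
  then obtain \<pi> :: "operator \<Rightarrow> 'k \<Rightarrow>\<^sub>L 'k" where irr: "irreducible_representation alg \<pi>"
    and inj: "inj_on \<pi> alg"
    unfolding primitive_on_def by blast
  have rep: "star_representation alg \<pi>"
    using irr by (simp add: irreducible_representation_def)
  have zero_alg: "0 \<in> alg"
    using cstar_subalgebra_alg by (simp add: cstar_subalgebra_def op_subspace_def)
  have zero: "\<pi> 0 = 0"
    using rep zero_alg by (rule star_representation_zero)
  have faithful: "\<pi> (cyl_proj c) \<noteq> 0" if "1 \<le> length c" for c
    using inj_onD[OF inj _ cyl_proj_in_alg[OF that] zero_alg] zero cyl_proj_nonzero[of c] by auto
  obtain v where v: "\<pi> (cyl_proj [0]) v \<noteq> 0"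
    using faithful[of "[0]"] blinfun_eqI[of "\<pi> (cyl_proj [0])" 0] by auto
  define Z where "Z = cyl_proj ` {c. 1 \<le> length c \<and> \<pi> (cyl_proj c) v \<noteq> 0}"
  have "cyl_projs \<subseteq> alg"
    using generators_in_alg by blast
  then have "countable Z"
    unfolding Z_def by (intro countable_image countable_cyl_projs_not_killing[OF cstar_subalgebra_alg _ rep])
  moreover have "Z \<subseteq> cyl_projs"
    unfolding Z_def cyl_projs_def by blast
  ultimately have "Z \<in> \<phi>\<^sub>2 ` Field r"
    using bij_\<phi>\<^sub>2 unfolding bij_betw_def by blast
  then obtain \<tau> where \<tau>: "\<tau> \<in> Field r" "Z = \<phi>\<^sub>2 \<tau>"
    by blast
  obtain \<sigma> where \<sigma>: "\<sigma> \<in> Field r" "\<tau> \<in> below r \<sigma>"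
    using exists_above[OF \<tau>(1)] by blast
  let ?P = "cyl_proj (a \<sigma>)"
  have "cyl_proj c \<in> \<phi>\<^sub>2 \<tau>" if "1 \<le> length c" "\<pi> (cyl_proj c) v \<noteq> 0" for c
    using that unfolding \<tau>(2)[symmetric] Z_def by blast
  then have "\<pi> ?P (\<pi> T v) = 0" if "T \<in> alg" for T
    using annihilates_orbit[OF rep _ \<tau>(1) \<sigma> that] by blast
  then have "(\<lambda>T. \<pi> T v) ` alg \<subseteq> {x. \<pi> ?P x = 0}"
    by blast
  moreover have "closed {x. \<pi> ?P x = 0}"
    by (intro closed_Collect_eq continuous_intros)
  ultimately have "closure ((\<lambda>T. \<pi> T v) ` alg) \<subseteq> {x. \<pi> ?P x = 0}"
    by (rule closure_minimal)
  moreover have "x \<in> closure ((\<lambda>T. \<pi> T v) ` alg)" for x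
    using irreducible_cyclic[OF cstar_subalgebra_alg irr cyl_proj_in_alg v] by simp
  ultimately have "\<pi> ?P = 0"
    by (intro blinfun_eqI) auto
  then show False
    using faithful[of "a \<sigma>"] step_lengths[OF \<sigma>(1)] by simp
qed

end

theorem mainTheorem1:
  fixes r :: "'i rel"
    and \<phi>\<^sub>1 :: "'i \<Rightarrow> operator \<times> operator"
    and \<phi>\<^sub>2 :: "'i \<Rightarrow> operator set"
    and n :: "'i \<Rightarrow> nat"
    and a b :: "'i \<Rightarrow> real list"
  assumes "transfinite_construction r \<phi>\<^sub>1 \<phi>\<^sub>2 n a b"
  shows "prime_cstar (cstar_generated (cyl_projs \<union> isometries r a b)) \<and>
    \<not> primitive_on TYPE('k::chilbert_space) (cstar_generated (cyl_projs \<union> isometries r a b))"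
proof -
  interpret transfinite_construction r \<phi>\<^sub>1 \<phi>\<^sub>2 n a b
    by (rule assms)
  show ?thesis
    using prime_alg not_primitive_alg ..
qed

end
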